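(* Let $q$ be a prime power and let $(V,\mathcal{R}) = (\mathbb{F}_q, \{R_0,R_1,R_2,R_3\})$ be the cyclotomic scheme of class $3$ on $\mathbb{F}_q$ (so $3$ divides $q-1$), defined with respect to a primitive element $\alpha$ of $\mathbb{F}_q$, and suppose that it is symmetric. For any $i \in \{1,2,3\}$, denote by $\Gamma_i$ and $\overline{\Gamma_i}$ the graphs on the vertex set $V=\mathbb{F}_q$ such that the adjacency relation of $\Gamma_i$ is $R_i$ and the adjacency relation of $\overline{\Gamma_i}$ is the union of the relations $R_j$ and $R_k$, where $\{i,j,k\} = \{1,2,3\}$. Then the following statements hold. (1) For any $i\in\{1,2,3\}$, $\Gamma_i = Cay(\mathbb{F}_q^+, \alpha^i S)$ and $\overline{\Gamma_i} = Cay(\mathbb{F}_q^+, \mathbb{F}_q^* \setminus \alpha^i S)$, where $S = \langle \alpha^3\rangle$ is the subgroup of index $3$ in $\mathbb{F}_q^*$. (2) The graphs $\Gamma_1$, $\Gamma_2$ and $\Gamma_3$ are isomorphic. (3) The graphs $\overline{\Gamma_1}$, $\overline{\Gamma_2}$ and $\overline{\Gamma_3}$ are isomorphic. (4) The graph $\Gamma_1$ is a strictly Deza graph if and only if $q$ is prime and there exists an integer $x$ such that $q = x^2+3$. (5) The graph $\overline{\Gamma_3}$ is a strictly Deza graph if and only if $q$ is prime and there exists an integer $x$ such that $q = x^2+12$.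
   Context: Graphs are finite, undirected and simple. For vertices $u,v$, $N(u,v)$ denotes the set of common neighbours of $u$ and $v$. A graph is strongly regular with parameters $(n,k,\lambda,\mu)$ if it has $n$ vertices, is $k$-regular, any two adjacent vertices have exactly $\lambda$ common neighbours, and any two distinct non-adjacent vertices have exactly $\mu$ common neighbours. Let $n,k,b,a$ be integers with $0\le a\le b\le k<n$. A graph is a Deza graph with parameters $(n,k,b,a)$ if it has $n$ vertices, is $k$-regular, and for any two distinct vertices $u,v$ the number $|N(u,v)|$ takes precisely the values $a$ or $b$ (there is a pair of distinct vertices with $a$ common neighbours and a pair with $b$ common neighbours). A strictly Deza graph is a Deza graph that has diameter $2$ and is not strongly regular. Cyclotomic scheme: let $q$ be a prime power, $e$ a divisor of $q-1$, and $\alpha$ a primitive element of $\mathbb{F}_q$. The subgroup $\langle\alpha^e\rangle$ of $\mathbb{F}_q^*$ has index $e$. Put $R_0 = \{(x,x) \mid x\in\mathbb{F}_q\}$ and $R_i = \{(x,y) \mid x,y \in \mathbb{F}_q,\ x-y\in\alpha^i\langle\alpha^e\rangle\}$ for $1\le i\le e$. Then $(\mathbb{F}_q,\{R_i\}_{i=0}^e)$ is the cyclotomic scheme of class $e$ on $\mathbb{F}_q$. It is called symmetric if all relations $R_i$ are symmetric. For a group $G$ and a subset $T\subseteq G$ with $e_G\notin T$ and $T^{-1}=T$, $Cay(G,T)$ is the graph with vertex set $G$ in which $x,y$ are adjacent if and only if $xy^{-1}\in T$. Here $\mathbb{F}_q^+$ and $\mathbb{F}_q^*$ denote the additive and multiplicative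 groups of $\mathbb{F}_q$.
   Formalization: Statement (4) is asserted only for q ≠ 7: for q = 7 the graph Γ_1 is the 7-cycle, which has diameter 3 and so is not a strictly Deza graph, although 7 is prime and 7 = 2²+3. *)

theory Defs
  imports
    "Graph_Theory.Graph_Theory"
    "HOL-Library.Cardinality"
    "HOL-Number_Theory.Prime_Powers"
begin

text \<open>
  A finite, undirected, simple graph is a \<^term>\<open>G\<close> satisfying \<^locale>\<open>pair_graph\<close>: every edge
  is represented by its two orientations, so the out-degree is the usual degree.
\<close>

definition common_neighbours :: "'v pair_pre_digraph \<Rightarrow> 'v \<Rightarrow> 'v \<Rightarrow> 'v set" where
  "common_neighbours G u v = {w \<in> pverts G. (u, w) \<in> parcs G \<and> (v, w) \<in> parcs G}"

definition regular_graph :: "'v pair_pre_digraph \<Rightarrow> nat \<Rightarrow> bool" where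
  "regular_graph G k \<longleftrightarrow> (\<forall>v \<in> pverts G. out_degree (with_proj G) v = k)"

definition strongly_regular ::
  "'v pair_pre_digraph \<Rightarrow> nat \<Rightarrow> nat \<Rightarrow> nat \<Rightarrow> nat \<Rightarrow> bool" where
  "strongly_regular G n k l m \<longleftrightarrow>
     pair_graph G \<and> card (pverts G) = n \<and> regular_graph G k \<and>
     (\<forall>u \<in> pverts G. \<forall>v \<in> pverts G.
        (u, v) \<in> parcs G \<longrightarrow> card (common_neighbours G u v) = l) \<and>
     (\<forall>u \<in> pverts G. \<forall>v \<in> pverts G.
        u \<noteq> v \<and> (u, v) \<notin> parcs G \<longrightarrow> card (common_neighbours G u v) = m)"

definition deza_graph ::
  "'v pair_pre_digraph \<Rightarrow> nat \<Rightarrow> nat \<Rightarrow> nat \<Rightarrow> nat \<Rightarrow> bool" where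
  "deza_graph G n k b a \<longleftrightarrow>
     a \<le> b \<and> b \<le> k \<and> k < n \<and>
     pair_graph G \<and> card (pverts G) = n \<and> regular_graph G k \<and>
     {card (common_neighbours G u v) | u v. u \<in> pverts G \<and> v \<in> pverts G \<and> u \<noteq> v} = {a, b}"

text \<open>With unit weights, \<^const>\<open>wf_digraph.\<mu>\<close> is the graph distance (infinite if unreachable).\<close>

definition graph_diameter :: "'v pair_pre_digraph \<Rightarrow> ereal" where
  "graph_diameter G = (SUP u \<in> pverts G. SUP v \<in> pverts G. wf_digraph.\<mu> (with_proj G) (\<lambda>_. 1) u v)"

definition strictly_deza_graph :: "'v pair_pre_digraph \<Rightarrow> bool" where
  "strictly_deza_graph G \<longleftrightarrow>
     (\<exists>n k b a. deza_graph G n k b a) \<and> graph_diameter G = 2 \<and>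
     \<not> (\<exists>n k l m. strongly_regular G n k l m)"

definition isomorphic_graphs :: "'v pair_pre_digraph \<Rightarrow> 'w pair_pre_digraph \<Rightarrow> bool" where
  "isomorphic_graphs G H \<longleftrightarrow> digraph_iso (with_proj G) (with_proj H)"


definition connection_set :: "'g::group_add set \<Rightarrow> bool" where
  "connection_set T \<longleftrightarrow> 0 \<notin> T \<and> uminus ` T = T"

definition Cay :: "'g::group_add set \<Rightarrow> 'g pair_pre_digraph" where
  "Cay T = \<lparr>pverts = UNIV, parcs = {(x, y). x - y \<in> T}\<rparr>"


definition cyclic_subgroup :: "'a::field \<Rightarrow> 'a set" where
  "cyclic_subgroup x = range (\<lambda>j::int. x powi j)"

text \<open>This forces \<^prop>\<open>x \<noteq> 0\<close>, since \<^term>\<open>0 powi 1\<close> is \<^term>\<open>0\<close>.\<close>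

definition primitive_element :: "'a::field \<Rightarrow> bool" where
  "primitive_element x \<longleftrightarrow> cyclic_subgroup x = UNIV - {0}"

definition cyclotomic_class :: "'a::field \<Rightarrow> nat \<Rightarrow> nat \<Rightarrow> 'a set" where
  "cyclotomic_class \<alpha> e i = (\<lambda>s. \<alpha> ^ i * s) ` cyclic_subgroup (\<alpha> ^ e)"

text \<open>The indices \<open>0, \<dots>, e\<close> are relevant; index \<open>e\<close> gives the subgroup itself.\<close>

definition cyclotomic_relation :: "'a::field \<Rightarrow> nat \<Rightarrow> nat \<Rightarrow> 'a rel" where
  "cyclotomic_relation \<alpha> e i =
     (if i = 0 then Id else {(x, y). x - y \<in> cyclotomic_class \<alpha> e i})"

definition symmetric_cyclotomic_scheme :: "'a::field \<Rightarrow> nat \<Rightarrow> bool" where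
  "symmetric_cyclotomic_scheme \<alpha> e \<longleftrightarrow> (\<forall>i \<in> {0..e}. sym (cyclotomic_relation \<alpha> e i))"

text \<open>
  Over the field with 7 elements, the group generated by \<open>\<alpha> ^ 3\<close> is \<open>{1, -1}\<close> and the following
  graph is the 7-cycle: a Deza graph of diameter 3, hence not a strictly Deza graph,
  although \<open>7 = 2\<^sup>2 + 3\<close>.
\<close>

definition Gamma :: "'a::field \<Rightarrow> nat \<Rightarrow> 'a pair_pre_digraph" where
  "Gamma \<alpha> i = \<lparr>pverts = UNIV, parcs = cyclotomic_relation \<alpha> 3 i\<rparr>"

definition Gamma_bar :: "'a::field \<Rightarrow> nat \<Rightarrow> 'a pair_pre_digraph" where
  "Gamma_bar \<alpha> i =
     \<lparr>pverts = UNIV, parcs = (\<Union>j \<in> {1, 2, 3} - {i}. cyclotomic_relation \<alpha> 3 j)\<rparr>"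

end

theory Submission
  imports Defs "HOL-Number_Theory.Cong"
begin

text \<open>
  The number of common neighbours of two vertices depends only on the cyclotomic class of their
  difference. For \<open>\<Gamma>\<^sub>1\<close> the three values are cyclotomic numbers \<open>A\<close> (adjacent vertices), \<open>B\<close> and \<open>C\<close>, and for
  the complement of \<open>\<Gamma>\<^sub>3\<close> they are \<open>B + C + 2 A + 2\<close> (non-adjacent vertices), \<open>A + B + 2 C\<close> and
  \<open>A + C + 2 B\<close>. Associativity of the convolution of class indicators gives \<open>4 q = c\<^sup>2 + 27 d\<^sup>2\<close> with
  \<open>c = 9 A - q + 8\<close> and \<open>d = C - B\<close>. A strictly Deza graph requires \<open>d \<noteq> 0\<close> and one more coincidence,
  which says \<open>c \<plusminus> 3 d = 4\<close>, that is \<open>q = (3 d \<minusplus> 1)\<^sup>2 + 3\<close>, respectively \<open>c \<plusminus> 3 d = - 8\<close>, that is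
  \<open>q = (3 d \<plusminus> 2)\<^sup>2 + 12\<close>. For the converse, the representation \<open>4 q = c\<^sup>2 + 27 d\<^sup>2\<close> is unique when \<open>q\<close> is
  prime.

  If \<open>q = p\<^sup>m\<close> with \<open>p\<close> odd, factoring in \<open>\<int>[\<surd>-3]\<close> turns \<open>q = x\<^sup>2 + 3 y\<^sup>2\<close> for \<open>y = 1, 2\<close> into
  \<open>Im (\<beta>\<^sup>m) = \<plusminus> Im \<beta>\<close> with \<open>\<beta>\<close> of norm \<open>p\<close>. For the plus sign, the 3-adic valuation of
  \<open>Im (\<beta>\<^sup>m) - Im \<beta>\<close> forces \<open>m = 1\<close>; the minus sign is impossible modulo 4 for \<open>y = 1\<close>, and for \<open>y = 2\<close> it
  would make \<open>- 2\<close> a square modulo a number congruent to 5 modulo 8.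
\<close>

section \<open>Integers with a square root of -3 adjoined\<close>

text \<open>\<open>Zr3 a b\<close> stands for \<open>a + b \<surd>-3\<close>.\<close>

datatype zr3 = Zr3 (rp: int) (ip: int)

instantiation zr3 :: comm_ring_1
begin
definition "0 = Zr3 0 0"
definition "1 = Zr3 1 0"
definition "z + w = Zr3 (rp z + rp w) (ip z + ip w)"
definition "z - w = Zr3 (rp z - rp w) (ip z - ip w)"
definition "- z = Zr3 (- rp z) (- ip z)"
definition "z * w = Zr3 (rp z * rp w - 3 * ip z * ip w) (rp z * ip w + ip z * rp w)"
instance
  by standard
    (simp_all add: zero_zr3_def one_zr3_def plus_zr3_def minus_zr3_def uminus_zr3_def
      times_zr3_def algebra_simps)
end

lemma zr3_parts [simp]:
  "rp 0 = 0" "ip 0 = 0" "rp 1 = 1" "ip 1 = 0"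
  "rp (z + w) = rp z + rp w" "ip (z + w) = ip z + ip w"
  "rp (z - w) = rp z - rp w" "ip (z - w) = ip z - ip w"
  "rp (- z) = - rp z" "ip (- z) = - ip z"
  "rp (z * w) = rp z * rp w - 3 * ip z * ip w" "ip (z * w) = rp z * ip w + ip z * rp w"
  by (simp_all add: zero_zr3_def one_zr3_def plus_zr3_def minus_zr3_def uminus_zr3_def
      times_zr3_def)

lemma of_nat_zr3: "of_nat n = Zr3 (int n) 0"
  by (induction n) (simp_all add: zero_zr3_def one_zr3_def plus_zr3_def)

lemma of_int_zr3: "of_int n = Zr3 n 0"
  by (cases n rule: int_diff_cases) (simp add: of_nat_zr3 minus_zr3_def)

lemma zr3_parts_of_int [simp]: "rp (of_int n) = n" "ip (of_int n) = 0"
  by (simp_all add: of_int_zr3)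

lemma zr3_parts_of_nat [simp]: "rp (of_nat n) = int n" "ip (of_nat n) = 0"
  by (simp_all add: of_nat_zr3)

lemma zr3_parts_numeral [simp]: "rp (numeral n) = numeral n" "ip (numeral n) = 0"
  using zr3_parts_of_int[of "numeral n"] by simp_all

lemma dvd_zr3_iff: "of_int n dvd z \<longleftrightarrow> n dvd rp z \<and> n dvd ip z"
proof
  assume "n dvd rp z \<and> n dvd ip z"
  then obtain x y where "rp z = n * x" "ip z = n * y" by (auto elim!: dvdE)
  then have "z = of_int n * Zr3 x y" by (intro zr3.expand) simp
  then show "of_int n dvd z" by simp
qed (auto elim!: dvdE)

definition zcnj :: "zr3 \<Rightarrow> zr3" where "zcnj z = Zr3 (rp z) (- ip z)"

definition znorm :: "zr3 \<Rightarrow> int" where "znorm z = (rp z)\<^sup>2 + 3 * (ip z)\<^sup>2"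

lemma zcnj_parts [simp]: "rp (zcnj z) = rp z" "ip (zcnj z) = - ip z"
  by (simp_all add: zcnj_def)

lemma zcnj_mult: "zcnj (z * w) = zcnj z * zcnj w"
  by (intro zr3.expand) simp

lemma zcnj_power: "zcnj (z ^ n) = zcnj z ^ n"
  by (induction n) (auto simp: zcnj_mult intro: zr3.expand)

lemma mult_zcnj: "z * zcnj z = of_int (znorm z)"
  by (intro zr3.expand) (simp add: znorm_def power2_eq_square)

lemma znorm_mult: "znorm (z * w) = znorm z * znorm w"
  by (simp add: znorm_def power2_eq_square algebra_simps)

lemma znorm_zcnj [simp]: "znorm (zcnj z) = znorm z"
  by (simp add: znorm_def)

section \<open>Odd primes of the form \<open>a^2 + 3 b^2\<close>\<close>

lemma square_mod_4: "(u::int)\<^sup>2 mod 4 = (if even u then 0 else 1)"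
proof (cases "even u")
  case True
  then obtain k where "u = 2 * k" by blast
  then show ?thesis by (simp add: power2_eq_square)
next
  case False
  then obtain k where "u = 2 * k + 1" by (blast elim: oddE)
  then have "u\<^sup>2 = 4 * (k * k + k) + 1" by (simp add: power2_eq_square algebra_simps)
  then show ?thesis using False by presburger
qed

text \<open>Thue's argument: a box of more than \<open>p\<close> points yields small
  \<open>u\<close>, \<open>v\<close>, not both zero, with \<open>u^2 + 3 v^2 = p r\<close> and
  \<open>0 < r < 4\<close>. The value \<open>r = 2\<close> fails modulo 4, and \<open>r = 3\<close>
  reduces to \<open>r = 1\<close> because then \<open>3\<close> divides \<open>u\<close>.\<close>

lemma square_plus_three_square_prime:
  fixes p x y :: int
  assumes p: "prime p" "odd p" and dvd: "p dvd x\<^sup>2 + 3 * y\<^sup>2" and y: "\<not> p dvd y"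
  shows "\<exists>a b. p = a\<^sup>2 + 3 * b\<^sup>2"
proof -
  have p0: "p > 0" using p by (simp add: prime_gt_0_int)
  define k where "k = nat \<lfloor>sqrt (real_of_int p)\<rfloor>"
  have k0: "real k \<le> sqrt p" and k1: "sqrt p < real k + 1"
    using p0 unfolding k_def by (auto simp: of_nat_nat)
  have "p < (int k + 1)\<^sup>2"
  proof -
    have "real_of_int p = (sqrt p)\<^sup>2" using p0 by simp
    also have "\<dots> < (real k + 1)\<^sup>2" using k1 p0 by (intro power_strict_mono) auto
    finally have "real_of_int p < of_int ((int k + 1)\<^sup>2)" by simp
    then show ?thesis by linarith
  qed
  have "(int k)\<^sup>2 \<le> p"
  proof -
    have "(real k)\<^sup>2 \<le> (sqrt p)\<^sup>2" using k0 by (intro power_mono) auto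
    then have "of_int ((int k)\<^sup>2) \<le> real_of_int p" using p0 by simp
    then show ?thesis by linarith
  qed
  have nsq: "(int k)\<^sup>2 \<noteq> p"
  proof
    assume "(int k)\<^sup>2 = p"
    then show False using p(1) by (metis  prime_power_iff numeral_eq_one_iff semiring_norm(85))
  qed
  then have kp: "(int k)\<^sup>2 < p" using \<open>(int k)\<^sup>2 \<le> p\<close> by simp
  define D where "D = {0..int k} \<times> {0..int k}"
  \<comment> \<open>For two points with the same value of \<open>h\<close>, the difference
    \<open>(u, v)\<close> satisfies \<open>u y = x v\<close> modulo \<open>p\<close>, so
    \<open>u^2 + 3 v^2\<close> inherits the divisibility of \<open>x^2 + 3 y^2\<close>.\<close>
  define h where "h = (\<lambda>(u, v). (u * y - x * v) mod p)"
  have "h ` D \<subseteq> {0..<p}" using p0 by (auto simp: h_def)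
  then have "card (h ` D) \<le> nat p" using card_mono[of "{0..<p}"] by fastforce
  also have "int (nat p) < (int k + 1)\<^sup>2" using p0 \<open>p < (int k + 1)\<^sup>2\<close> by simp
  then have "nat p < (k+1)\<^sup>2"
    by (metis of_nat_1 of_nat_add of_nat_less_iff of_nat_power)
  also have "\<dots> = card D" by (simp add: D_def card_cartesian_product power2_eq_square nat_add_distrib)
  finally have "\<not> inj_on h D" by (rule pigeonhole)
  then obtain s t where st: "s \<in> D" "t \<in> D" "s \<noteq> t" "h s = h t" unfolding inj_on_def by blast
  define u v where "u = fst s - fst t" and "v = snd s - snd t"
  have uv: "\<bar>u\<bar> \<le> int k" "\<bar>v\<bar> \<le> int k" using st by (auto simp: D_def u_def v_def abs_if)
  have "p dvd u * y - x * v" using st(4)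
    by (simp add: h_def case_prod_beta mod_eq_dvd_iff u_def v_def algebra_simps)
  moreover have "y\<^sup>2 * (u\<^sup>2 + 3 * v\<^sup>2) = (u * y - x * v) * (u * y + x * v) + (x\<^sup>2 + 3 * y\<^sup>2) * v\<^sup>2"
    by (simp add: power2_eq_square algebra_simps)
  ultimately have "p dvd y\<^sup>2 * (u\<^sup>2 + 3 * v\<^sup>2)" using dvd by simp
  then have "p dvd u\<^sup>2 + 3 * v\<^sup>2"
    using p(1) y by (auto simp: prime_dvd_mult_iff dest: prime_dvd_power)
  then obtain r where r: "u\<^sup>2 + 3 * v\<^sup>2 = p * r" by blast
  have "u\<^sup>2 \<le> (int k)\<^sup>2" "v\<^sup>2 \<le> (int k)\<^sup>2" using uv by (simp_all add: abs_le_square_iff[symmetric])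
  then have "p * r < p * 4" using r kp by linarith
  then have "r < 4" using p0 by simp
  have "u \<noteq> 0 \<or> v \<noteq> 0" using st(3) by (auto simp: u_def v_def prod_eq_iff)
  then have "u\<^sup>2 + 3 * v\<^sup>2 > 0" by (metis add.commute add_nonneg_pos add_pos_nonneg mult_pos_pos zero_le_mult_iff zero_le_power2 zero_less_numeral zero_less_power2 order_less_imp_le)
  then have "r > 0" using r p0 by (simp add: zero_less_mult_iff)
  then consider "r = 1" | "r = 2" | "r = 3" using \<open>r < 4\<close> by linarith
  then show ?thesis
  proof cases
    case 2
    have "u\<^sup>2 mod 4 = (if even u then 0 else 1)" "v\<^sup>2 mod 4 = (if even v then 0 else 1)"
      by (rule square_mod_4)+
    then have "(u\<^sup>2 + 3 * v\<^sup>2) mod 4 \<noteq> 2" by (auto split: if_splits; presburger)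
    moreover have "(p * 2) mod 4 = 2" using p(2) by presburger
    ultimately show ?thesis using r 2 by simp
  next
    case 3
    then have "3 dvd u\<^sup>2" using r by presburger
    then have "3 dvd u" using prime_dvd_power_int[of 3 u 2] by simp
    then obtain w where "u = 3 * w" by blast
    then have "p = v\<^sup>2 + 3 * w\<^sup>2" using r 3 by (simp add: power2_eq_square)
    then show ?thesis by blast
  qed (use r in auto)
qed

section \<open>Elements of prime power norm\<close>

lemma znorm_eq_1: "znorm z = 1 \<Longrightarrow> z = 1 \<or> z = - 1"
proof -
  assume n: "znorm z = 1"
  have "ip z = 0"
  proof (rule ccontr)
    assume "ip z \<noteq> 0"
    then have "(ip z)\<^sup>2 > 0" by simp
    moreover have "(rp z)\<^sup>2 \<ge> 0" by simp
    ultimately show False using n unfolding znorm_def by linarith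
  qed
  moreover from this have "rp z = 1 \<or> rp z = - 1"
    using n by (simp add: znorm_def power2_eq_1_iff)
  ultimately show ?thesis by (auto intro: zr3.expand)
qed

text \<open>The last hypothesis concerns the imaginary part of \<open>z * zcnj \<rho>\<close>. The
  norm of this product is divisible by \<open>p\<close>, hence so is its real part. Thus it equals
  \<open>p * w\<close>, and multiplying by \<open>\<rho>\<close> and cancelling \<open>p\<close>
  leaves \<open>z = \<rho> * w\<close>.\<close>

lemma znorm_dvd_step:
  assumes p: "prime p" and \<rho>: "znorm \<rho> = p" and z: "p dvd znorm z"
    and dvd: "p dvd ip z * rp \<rho> - rp z * ip \<rho>"
  shows "\<rho> dvd z"
proof -
  have "ip (z * zcnj \<rho>) = ip z * rp \<rho> - rp z * ip \<rho>" by simp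
  then have ip: "p dvd ip (z * zcnj \<rho>)" using dvd by simp
  have "p dvd znorm (z * zcnj \<rho>)" using z by (simp add: znorm_mult)
  then have "p dvd (rp (z * zcnj \<rho>))\<^sup>2"
    using ip unfolding znorm_def by (metis dvd_add_left_iff dvd_mult dvd_mult2 power2_eq_square)
  then have "p dvd rp (z * zcnj \<rho>)" using p by (rule prime_dvd_power[rotated])
  then have "of_int p dvd z * zcnj \<rho>" using ip by (simp add: dvd_zr3_iff)
  then obtain w where w: "z * zcnj \<rho> = of_int p * w" by blast
  have "of_int p * z = of_int p * (\<rho> * w)"
    using w \<rho> by (metis mult.assoc mult.commute mult_zcnj)
  then have "p * rp z = p * rp (\<rho> * w)" "p * ip z = p * ip (\<rho> * w)"
    by (auto dest: arg_cong[where f = rp] arg_cong[where f = ip])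
  then have "z = \<rho> * w" using p by (intro zr3.expand) auto
  then show ?thesis by simp
qed

text \<open>The ring lacks unique factorization, so the factors of norm \<open>p\<close> are split
  off one at a time. Two different conjugates can never both occur, since their product
  \<open>p\<close> would divide \<open>z\<close>.\<close>

lemma primitive_prime_power_norm:
  assumes p: "prime p" and \<pi>: "znorm \<pi> = p"
    and z: "znorm z = p ^ m" "\<not> of_int p dvd z"
  shows "\<exists>\<rho> \<in> {\<pi>, zcnj \<pi>}. z = \<rho> ^ m \<or> z = - (\<rho> ^ m)"
  using z
proof (induction m arbitrary: z)
  case 0
  then show ?case using znorm_eq_1 by auto
next
  case (Suc m)
  \<comment> \<open>Both norms on the right are multiples of \<open>p\<close>, so \<open>p\<close>
    divides a factor on the left. Which one decides whether \<open>\<pi>\<close> or its conjugate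
    can be split off.\<close>
  have "(ip z * rp \<pi> - rp z * ip \<pi>) * (ip z * rp \<pi> + rp z * ip \<pi>) =
      (ip z)\<^sup>2 * znorm \<pi> - (ip \<pi>)\<^sup>2 * znorm z"
    by (simp add: znorm_def power2_eq_square algebra_simps)
  then have "p dvd (ip z * rp \<pi> - rp z * ip \<pi>) * (ip z * rp \<pi> + rp z * ip \<pi>)"
    using Suc.prems(1) \<pi> by simp
  then consider "p dvd ip z * rp \<pi> - rp z * ip \<pi>" | "p dvd ip z * rp \<pi> + rp z * ip \<pi>"
    using p by (auto simp: prime_dvd_mult_iff)
  then obtain \<rho> where \<rho>: "\<rho> \<in> {\<pi>, zcnj \<pi>}" "\<rho> dvd z"
  proof cases
    case 1
    then show ?thesis using that[of \<pi>] znorm_dvd_step[OF p \<pi>, of z] Suc.prems(1) by auto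
  next
    case 2
    then show ?thesis using that[of "zcnj \<pi>"] znorm_dvd_step[of p "zcnj \<pi>" z] p \<pi> Suc.prems(1)
      by auto
  qed
  have n\<rho>: "znorm \<rho> = p" using \<rho>(1) \<pi> by auto
  obtain w where w: "z = \<rho> * w" using \<rho>(2) by blast
  have "p * znorm w = p * p ^ m" using Suc.prems(1) n\<rho> by (simp add: w znorm_mult)
  then have "znorm w = p ^ m" using p by auto
  moreover have "\<not> of_int p dvd w" using Suc.prems(2) w by auto
  ultimately obtain \<sigma> where \<sigma>: "\<sigma> \<in> {\<pi>, zcnj \<pi>}" "w = \<sigma> ^ m \<or> w = - (\<sigma> ^ m)"
    using Suc.IH by blast
  show ?case
  proof (cases "m = 0 \<or> \<sigma> = \<rho>")
    case True
    then have "z = \<rho> ^ Suc m \<or> z = - (\<rho> ^ Suc m)" using \<sigma>(2) w by auto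
    then show ?thesis using \<rho>(1) by blast
  next
    case False
    then obtain m' where m': "m = Suc m'" using not0_implies_Suc by blast
    have "\<sigma> = zcnj \<rho>" using False \<rho>(1) \<sigma>(1) by (auto intro: zr3.expand)
    then have "\<rho> * \<sigma> = of_int p" using n\<rho> mult_zcnj by simp
    then have "z = of_int p * \<sigma> ^ m' \<or> z = - (of_int p * \<sigma> ^ m')"
      using \<sigma>(2) w m' by (auto simp: mult.assoc[symmetric])
    then show ?thesis using Suc.prems(2) by auto
  qed
qed

text \<open>Turns the equation into a statement about the imaginary part of a power. A prime is not
  a square, so \<open>ip \<rho>\<close> is nonzero, and conjugation makes it positive.\<close>

lemma prime_power_representation:
  fixes p x y :: int
  assumes p: "prime p" "odd p" and y: "\<not> p dvd y" and eq: "x\<^sup>2 + 3 * y\<^sup>2 = p ^ m" and m: "m > 0"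
  shows "\<exists>\<beta>. znorm \<beta> = p \<and> ip \<beta> > 0 \<and> \<bar>ip (\<beta> ^ m)\<bar> = \<bar>y\<bar>"
proof -
  have "p dvd x\<^sup>2 + 3 * y\<^sup>2" using eq m by simp
  then obtain a b where ab: "p = a\<^sup>2 + 3 * b\<^sup>2"
    using square_plus_three_square_prime p y by blast
  define \<pi> where "\<pi> = Zr3 a b"
  have "znorm \<pi> = p" by (simp add: \<pi>_def znorm_def ab)
  moreover have "znorm (Zr3 x y) = p ^ m" by (simp add: znorm_def eq)
  moreover have "\<not> of_int p dvd Zr3 x y" using y by (simp add: dvd_zr3_iff)
  ultimately obtain \<rho> where \<rho>: "\<rho> \<in> {\<pi>, zcnj \<pi>}" "Zr3 x y = \<rho> ^ m \<or> Zr3 x y = - (\<rho> ^ m)"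
    using primitive_prime_power_norm p by blast
  have im: "\<bar>ip (\<rho> ^ m)\<bar> = \<bar>y\<bar>" using \<rho>(2)
    by (metis abs_minus_cancel zr3.sel(2) zr3_parts(10))
  have n: "znorm \<rho> = p" using \<rho>(1) \<open>znorm \<pi> = p\<close> by auto
  have "ip \<rho> \<noteq> 0"
  proof
    assume "ip \<rho> = 0"
    then have "(rp \<rho>)\<^sup>2 = p" using n by (simp add: znorm_def)
    then show False using p(1) by (metis prime_power_iff numeral_eq_one_iff semiring_norm(85))
  qed
  then consider "ip \<rho> > 0" | "ip (zcnj \<rho>) > 0" by fastforce
  then show ?thesis
  proof cases
    case 2
    have "ip (zcnj \<rho> ^ m) = - ip (\<rho> ^ m)" by (simp flip: zcnj_power)
    then show ?thesis using 2 n im by (intro exI[of _ "zcnj \<rho>"]) simp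
  qed (use n im in auto)
qed

section \<open>3-adic expansion of powers\<close>

lemma cube_power_approx:
  fixes \<delta> :: "'a::comm_ring_1"
  shows "\<exists>\<eta>. (1 + 9 * \<delta>) ^ (3 ^ s) = 1 + 9 * 3 ^ s * (\<delta> + 3 * \<eta>)"
proof (induction s)
  case 0
  show ?case by (rule exI[of _ 0]) simp
next
  case (Suc s)
  then obtain \<eta> where \<eta>: "(1 + 9 * \<delta>) ^ (3 ^ s) = 1 + 9 * 3 ^ s * (\<delta> + 3 * \<eta>)" by blast
  define \<kappa> and t :: 'a where "\<kappa> = \<delta> + 3 * \<eta>" and "t = 3 ^ s"
  have "(1 + 9 * \<delta>) ^ (3 ^ Suc s) = ((1 + 9 * \<delta>) ^ (3 ^ s)) ^ 3"
    by (simp add: power_mult[symmetric] mult.commute)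
  also have "\<dots> = (1 + 9 * t * \<kappa>) ^ 3"
    by (simp only: \<eta> \<kappa>_def t_def)
  \<comment> \<open>Cubing multiplies the deviation from 1 by 3; the square and cube terms of the
    expansion carry at least one further factor 3.\<close>
  also have "\<dots> = 1 + 9 * (3 * t) * (\<kappa> + 3 * (3 * t * \<kappa>\<^sup>2 + 9 * t\<^sup>2 * \<kappa> ^ 3))"
    by (simp add: algebra_simps power2_eq_square power3_eq_cube)
  also have "\<dots> = 1 + 9 * (3 * t) * (\<delta> + 3 * (\<eta> + 3 * t * \<kappa>\<^sup>2 + 9 * t\<^sup>2 * \<kappa> ^ 3))"
    by (simp add: \<kappa>_def algebra_simps)
  finally show ?case unfolding t_def power_Suc by blast
qed

lemma power_one_plus_approx:
  fixes \<kappa> :: "'a::comm_ring_1"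
  shows "\<exists>\<theta>. (1 + K * \<kappa>) ^ r = 1 + of_nat r * K * \<kappa> + K\<^sup>2 * \<theta>"
proof (induction r)
  case 0
  show ?case by (rule exI[of _ 0]) simp
next
  case (Suc r)
  then obtain \<theta> where \<theta>: "(1 + K * \<kappa>) ^ r = 1 + of_nat r * K * \<kappa> + K\<^sup>2 * \<theta>" by blast
  have "(1 + K * \<kappa>) ^ Suc r = (1 + K * \<kappa>) * (1 + of_nat r * K * \<kappa> + K\<^sup>2 * \<theta>)"
    using \<theta> by simp
  also have "\<dots> = 1 + of_nat (Suc r) * K * \<kappa> + K\<^sup>2 * (of_nat r * \<kappa>\<^sup>2 + \<theta> * (1 + K * \<kappa>))"
    by (simp add: algebra_simps power2_eq_square)
  finally show ?case by blast
qed

text \<open>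
  In the expansion of \<open>\<beta> (1 + 9 \<delta>)\<^sup>t\<close> the linear term has smaller 3-adic valuation than all later ones.
\<close>

lemma ip_mult_power_neq:
  assumes im: "\<not> 3 dvd ip (\<beta> * \<delta>)" and t: "t > 0"
  shows "ip (\<beta> * (1 + 9 * \<delta>) ^ t) \<noteq> ip \<beta>"
proof
  assume eq: "ip (\<beta> * (1 + 9 * \<delta>) ^ t) = ip \<beta>"
  define s where "s = multiplicity 3 t"
  obtain r where r: "t = 3 ^ s * r" "\<not> 3 dvd r"
    using multiplicity_decompose'[of t 3] t unfolding s_def by auto
  obtain \<eta> where \<eta>: "(1 + 9 * \<delta>) ^ (3 ^ s) = 1 + 9 * 3 ^ s * (\<delta> + 3 * \<eta>)"
    using cube_power_approx by blast
  obtain \<theta> where \<theta>: "(1 + 9 * 3 ^ s * (\<delta> + 3 * \<eta>)) ^ r =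
      1 + of_nat r * (9 * 3 ^ s) * (\<delta> + 3 * \<eta>) + (9 * 3 ^ s)\<^sup>2 * \<theta>"
    using power_one_plus_approx by blast
  define T :: int where "T = 3 ^ s"
  have T: "(3 :: zr3) ^ s = of_int T" by (simp add: T_def)
  have "T \<noteq> 0" by (simp add: T_def)
  have "\<beta> * (1 + 9 * \<delta>) ^ t = \<beta> * (1 + of_nat r * (9 * 3 ^ s) * (\<delta> + 3 * \<eta>) + (9 * 3 ^ s)\<^sup>2 * \<theta>)"
    by (simp only: r(1) power_mult \<eta> \<theta>)
  \<comment> \<open>The remainder term has the factor \<open>(9 * T)^2\<close>, so after removal of
    one \<open>9 * T\<close> it still vanishes modulo 3, and only
    \<open>r * ip (\<beta> * \<delta>)\<close> survives.\<close>
  also have "\<dots> = \<beta> + of_int (9 * T) *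
      (of_int (int r) * (\<beta> * \<delta>) + of_int 3 * (of_int (int r) * (\<beta> * \<eta>) + of_int (3 * T) * (\<beta> * \<theta>)))"
    unfolding T by (simp add: algebra_simps power2_eq_square)
  also have "ip \<dots> = ip \<beta> + 9 * T *
      (int r * ip (\<beta> * \<delta>) + 3 * (int r * ip (\<beta> * \<eta>) + 3 * T * ip (\<beta> * \<theta>)))"
    by (simp only: zr3_parts zr3_parts_of_int mult_zero_left add_0_right)
  finally have "int r * ip (\<beta> * \<delta>) = 3 * (- (int r * ip (\<beta> * \<eta>) + 3 * T * ip (\<beta> * \<theta>)))"
    using eq \<open>T \<noteq> 0\<close> by simp
  then have "3 dvd int r * ip (\<beta> * \<delta>)" by (metis dvd_triv_left)
  then have "3 dvd int r" using im prime_dvd_mult_iff[of "3::int"] by simp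
  then show False using r(2) by presburger
qed

text \<open>Descent on the modulus, which need not be prime: the cofactor of \<open>n\<close> in
  \<open>v^2 + 2\<close>, for a suitable odd \<open>v\<close>, is a smaller modulus of the same
  kind.\<close>

lemma not_dvd_square_plus_two:
  fixes n u :: int
  assumes "n > 0" "n mod 8 = 5 \<or> n mod 8 = 7"
  shows "\<not> n dvd u\<^sup>2 + 2"
  using assms
proof (induction "nat n" arbitrary: n u rule: less_induct)
  case less
  show ?case
  proof
    assume dvd: "n dvd u\<^sup>2 + 2"
    have "odd n" using less.prems(2) by presburger
    define r where "r = u mod n"
    have r: "0 \<le> r" "r < n" using less.prems(1) by (auto simp: r_def)
    have "(r\<^sup>2 + 2) mod n = (u\<^sup>2 + 2) mod n"
      unfolding r_def by (rule mod_add_cong) (simp_all add: power_mod)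
    then have "n dvd r\<^sup>2 + 2" using dvd by (simp add: dvd_eq_mod_eq_0)
    \<comment> \<open>The odd one of the two representatives \<open>r\<close> and
      \<open>n - r\<close> makes \<open>v^2 + 2\<close> congruent to 3 modulo 8.\<close>
    define v where "v = (if odd r then r else n - r)"
    have v: "odd v" "0 \<le> v" "v \<le> n" using r \<open>odd n\<close> by (auto simp: v_def)
    have "v\<^sup>2 + 2 = (r\<^sup>2 + 2) + n * (if odd r then 0 else n - 2 * r)"
      by (simp add: v_def power2_eq_square algebra_simps)
    then have "n dvd v\<^sup>2 + 2" using \<open>n dvd r\<^sup>2 + 2\<close> by (simp only: dvd_add dvd_triv_left)
    then obtain w where w: "v\<^sup>2 + 2 = n * w" by blast
    obtain j where "v = 2 * j + 1" using v(1) by (elim oddE)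
    then have "v\<^sup>2 + 2 = 4 * (j * (j + 1)) + 3" by (simp add: power2_eq_square algebra_simps)
    moreover obtain i where "j * (j + 1) = 2 * i"
      using even_mult_iff[of j "j + 1"] by (metis dvdE even_plus_one_iff)
    ultimately have "n * w = 3 + i * 8" using w by simp
    then have "(n * w) mod 8 = 3" by (simp only: mod_mult_self1) simp
    then have "((n mod 8) * (w mod 8)) mod 8 = 3" by (simp add: mod_mult_eq)
    moreover have "w mod 8 = 0 \<or> w mod 8 = 1 \<or> w mod 8 = 2 \<or> w mod 8 = 3 \<or>
        w mod 8 = 4 \<or> w mod 8 = 5 \<or> w mod 8 = 6 \<or> w mod 8 = 7" by presburger
    \<comment> \<open>As \<open>5 * 7\<close> is 3 modulo 8, the cofactor lies in the opposite one
      of the classes 5 and 7.\<close>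
    ultimately have w8: "w mod 8 = 5 \<or> w mod 8 = 7" using less.prems(2) by (elim disjE) simp_all
    have "n * w > 0" unfolding w[symmetric] by (simp add: add_nonneg_pos)
    then have "w > 0" using less.prems(1) by (simp add: zero_less_mult_iff)
    have "n \<ge> 5" using less.prems by presburger
    have "w < n"
    proof (rule ccontr)
      assume "\<not> w < n"
      then have "n * n \<le> v\<^sup>2 + 2" unfolding w using less.prems(1) by simp
      moreover have "v \<noteq> n"
      proof
        assume "v = n"
        then have "n dvd 2" using \<open>n dvd v\<^sup>2 + 2\<close> by (simp add: power2_eq_square)
        then show False using \<open>n \<ge> 5\<close> by (auto dest: zdvd_imp_le)
      qed
      then have "v * v \<le> (n - 1) * (n - 1)" using v by (intro mult_mono) auto
      then have "v\<^sup>2 + 2 \<le> n * n - 2 * n + 3" by (simp add: power2_eq_square algebra_simps)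
      ultimately show False using \<open>n \<ge> 5\<close> by linarith
    qed
    moreover have "w dvd v\<^sup>2 + 2" using w by simp
    ultimately show False using less.hyps[of w v] w8 \<open>w > 0\<close> less.prems(1) by simp
  qed
qed

lemma one_plus_nine_power: "\<exists>\<eta>. (1 + 9 * \<delta>) ^ t = 1 + 9 * (\<eta> :: 'a::comm_ring_1)"
proof -
  obtain \<theta> where "(1 + 9 * \<delta>) ^ t = 1 + of_nat t * 9 * \<delta> + 9\<^sup>2 * \<theta>"
    using power_one_plus_approx by blast
  also have "\<dots> = 1 + 9 * (of_nat t * \<delta> + 9 * \<theta>)" by (simp add: algebra_simps power2_eq_square)
  finally show ?thesis by blast
qed

lemma ip_dvd_ip_power: "ip z dvd ip (z ^ n)"
  by (induction n) auto

section \<open>The equations \<open>x\<^sup>2 + 3 = p\<^sup>m\<close> and \<open>x\<^sup>2 + 12 = p\<^sup>m\<close>\<close>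

lemma three_dvd_square_minus_1:
  fixes a :: int
  assumes "\<not> 3 dvd a"
  shows "3 dvd a\<^sup>2 - 1"
proof -
  have "a mod 3 = 1 \<or> a mod 3 = 2" using assms by presburger
  then obtain k where "a = 3 * k + 1 \<or> a = 3 * k + 2" by (metis mult_div_mod_eq)
  then have "a\<^sup>2 = 1 + 3 * (3 * k * k + 2 * k) \<or> a\<^sup>2 = 4 + 3 * (3 * k * k + 4 * k)"
    by (auto simp: power2_eq_square algebra_simps)
  then show ?thesis by presburger
qed

text \<open>Supplies the \<open>\<delta>\<close> of \<open>ip_mult_power_neq\<close>. Here
  \<open>a^2\<close> and \<open>b^2\<close> are both 1 modulo 3; substituting
  \<open>a^2 = b^2 + 3 B\<close> makes the divisibility by 9 explicit.\<close>

lemma Zr3_power_6: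
  assumes a: "\<not> 3 dvd a" and b: "b = 1 \<or> b = 2"
  shows "\<exists>\<delta>. Zr3 a b ^ 6 = 1 + 9 * \<delta> \<and> \<not> 3 dvd ip (Zr3 a b * \<delta>)"
proof -
  have "3 dvd a\<^sup>2 - 1" using a by (rule three_dvd_square_minus_1)
  moreover have "(3::int) dvd 1 - b\<^sup>2" using b by auto
  ultimately have "3 dvd a\<^sup>2 - b\<^sup>2" by presburger
  then obtain B where "a\<^sup>2 - b\<^sup>2 = 3 * B" by blast
  then have B: "a\<^sup>2 = b\<^sup>2 + 3 * B" by simp
  \<comment> \<open>\<open>P\<close> and \<open>2 a b\<close> are the coordinates of the square,
    which is then cubed.\<close>
  have p6: "Zr3 a b ^ 6 = Zr3 (P ^ 3 - 36 * P * a\<^sup>2 * b\<^sup>2) (6 * a * b * P\<^sup>2 - 24 * a * b * a\<^sup>2 * b\<^sup>2)"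
    if "a\<^sup>2 - 3 * b\<^sup>2 = P" for P
  proof -
    have "Zr3 a b * Zr3 a b = Zr3 P (2 * a * b)"
      using that by (intro zr3.expand) (simp add: power2_eq_square)
    moreover have "z ^ 6 = (z * z) * (z * z) * (z * z)" for z :: zr3
      by (simp add: power_numeral_reduce mult.assoc)
    ultimately have "Zr3 a b ^ 6 = Zr3 P (2 * a * b) * Zr3 P (2 * a * b) * Zr3 P (2 * a * b)"
      by simp
    then show ?thesis
      by (auto intro!: zr3.expand simp: power2_eq_square power3_eq_cube algebra_simps)
  qed
  from b show ?thesis
  proof
    assume [simp]: "b = 1"
    \<comment> \<open>The coordinates of \<open>Zr3 a b ^ 6 - 1\<close> divided by 9, with
      \<open>a^2\<close> replaced by \<open>1 + 3 B\<close>. The case \<open>b = 2\<close> uses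
      \<open>a^2 = 4 + 3 B\<close> in the same way.\<close>
    define \<delta> where "\<delta> = Zr3 (7 + 16*B - 42*B\<^sup>2 + 3*B^3) (2*a*B*(3*B - 8))"
    have "Zr3 a b ^ 6 = 1 + 9 * \<delta>"
      using p6[of "3 * B - 2"] B unfolding \<delta>_def
      by (auto intro!: zr3.expand simp: power2_eq_square power3_eq_cube algebra_simps)
    moreover have "ip (Zr3 a b * \<delta>) = 7 + 16*B - 42*B\<^sup>2 + 3*B^3 + 2 * a\<^sup>2 * B * (3*B - 8)"
      by (simp add: \<delta>_def power2_eq_square algebra_simps)
    then have "ip (Zr3 a b * \<delta>) = 1 + 3 * (2 - 28 * B\<^sup>2 + 7 * B ^ 3)"
      unfolding B by (simp add: power2_eq_square power3_eq_cube algebra_simps)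
    then have "\<not> 3 dvd ip (Zr3 a b * \<delta>)" by presburger
    ultimately show ?thesis by blast
  next
    assume [simp]: "b = 2"
    define \<delta> where "\<delta> = Zr3 (455 + 256*B - 168*B\<^sup>2 + 3*B^3) (4*a*B*(3*B - 32))"
    have "Zr3 a b ^ 6 = 1 + 9 * \<delta>"
      using p6[of "3 * B - 8"] B unfolding \<delta>_def
      by (auto intro!: zr3.expand simp: power2_eq_square power3_eq_cube algebra_simps)
    moreover have "ip (Zr3 a b * \<delta>) = 2 * (455 + 256*B - 168*B\<^sup>2 + 3*B^3) + 4 * a\<^sup>2 * B * (3*B - 32)"
      by (simp add: \<delta>_def power2_eq_square algebra_simps)
    then have "ip (Zr3 a b * \<delta>) = 910 + 3 * (14 * B ^ 3 - 224 * B\<^sup>2)"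
      unfolding B by (simp add: power2_eq_square power3_eq_cube algebra_simps)
    then have "\<not> 3 dvd ip (Zr3 a b * \<delta>)" by presburger
    ultimately show ?thesis by blast
  qed
qed

lemma ip_power_6_add:
  assumes "\<beta> ^ 6 = 1 + 9 * \<delta>"
  shows "9 dvd ip (\<beta> ^ (6 * t + r)) - ip (\<beta> ^ r)"
proof -
  obtain \<eta> where "(1 + 9 * \<delta>) ^ t = 1 + 9 * \<eta>" using one_plus_nine_power by blast
  then have "\<beta> ^ (6 * t + r) = (1 + 9 * \<eta>) * \<beta> ^ r"
    by (simp only: power_add power_mult assms)
  also have "\<dots> = \<beta> ^ r + 9 * (\<beta> ^ r * \<eta>)" by (simp add: algebra_simps)
  finally show ?thesis by simp
qed

lemma odd_decompose_6:
  fixes m :: nat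
  assumes "odd m"
  obtains t r where "m = 6 * t + r" "r = 1 \<or> r = 3 \<or> r = 5"
proof -
  have "m = 6 * (m div 6) + m mod 6" by simp
  moreover have "m mod 6 = 1 \<or> m mod 6 = 3 \<or> m mod 6 = 5" using assms by presburger
  ultimately show ?thesis using that by blast
qed

lemma Zr3_power_3: "ip (Zr3 a b ^ 3) = 3 * (b * (a\<^sup>2 - b\<^sup>2))"
  by (simp add: power3_eq_cube power2_eq_square algebra_simps)

lemma Zr3_power_5: "ip (Zr3 a b ^ 5) = 5 * a ^ 4 * b - 30 * a\<^sup>2 * b ^ 3 + 9 * b ^ 5"
  by (simp add: power_numeral_reduce algebra_simps)

text \<open>Modulo 9 only the residue of \<open>m\<close> modulo 6 matters. Residue 3 gives an
  imaginary part divisible by 3, and residue 5 gives \<open>5 b\<close> modulo 3; neither agrees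
  with \<open>b\<close>. For residue 1 the 3-adic estimate leaves only \<open>m = 1\<close>.\<close>

lemma ip_power_eq_imp:
  assumes a: "\<not> 3 dvd a" and b: "b = 1 \<or> b = 2" and m: "odd m"
    and eq: "ip (Zr3 a b ^ m) = b"
  shows "m = 1"
proof -
  obtain \<delta> where \<delta>: "Zr3 a b ^ 6 = 1 + 9 * \<delta>" "\<not> 3 dvd ip (Zr3 a b * \<delta>)"
    using Zr3_power_6 a b by blast
  obtain t r where tr: "m = 6 * t + r" "r = 1 \<or> r = 3 \<or> r = 5" using odd_decompose_6 m by blast
  have dvd: "9 dvd b - ip (Zr3 a b ^ r)"
    using ip_power_6_add[OF \<delta>(1), of t r] eq unfolding tr(1) by simp
  have r: "r = 1"
    using tr(2)
  proof (elim disjE)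
    assume "r = 3"
    then have "9 dvd b - 3 * (b * (a\<^sup>2 - b\<^sup>2))" using dvd Zr3_power_3 by simp
    then have "3 dvd b" by presburger
    then show ?thesis using b by auto
  next
    assume "r = 5"
    then have *: "9 dvd b - (5 * a ^ 4 * b - 30 * a\<^sup>2 * b ^ 3 + 9 * b ^ 5)" using dvd Zr3_power_5 by simp
    obtain c where "a\<^sup>2 - 1 = 3 * c" using three_dvd_square_minus_1[OF a] by blast
    then have c: "a\<^sup>2 = 1 + 3 * c" by simp
    have "a ^ 4 = (a\<^sup>2)\<^sup>2" by simp
    also have "\<dots> = 1 + 3 * (2 * c + 3 * c * c)" unfolding c by (simp add: power2_eq_square algebra_simps)
    finally have a4: "a ^ 4 = 1 + 3 * (2 * c + 3 * c * c)" .
    have "b - (5 * a ^ 4 * b - 30 * a\<^sup>2 * b ^ 3 + 9 * b ^ 5) =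
        b - 5 * b + 3 * (10 * a\<^sup>2 * b ^ 3 - 3 * b ^ 5 - 5 * b * (2 * c + 3 * c * c))"
      unfolding a4 by (simp add: algebra_simps)
    with * have "9 dvd b - 5 * b + 3 * (10 * a\<^sup>2 * b ^ 3 - 3 * b ^ 5 - 5 * b * (2 * c + 3 * c * c))"
      by simp
    then have "3 dvd b - 5 * b" by presburger
    then show ?thesis using b by auto
  qed
  have "Zr3 a b ^ m = (1 + 9 * \<delta>) ^ t * Zr3 a b"
    by (simp only: tr(1) r power_add power_mult \<delta>(1) power_one_right)
  then have "ip (Zr3 a b * (1 + 9 * \<delta>) ^ t) = ip (Zr3 a b)"
    using eq by (simp only: mult.commute zr3.sel)
  then have "t = 0" using ip_mult_power_neq[OF \<delta>(2)] by blast
  then show ?thesis using tr(1) r by simp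
qed

lemma prime_int_dvdD:
  fixes p k :: int
  assumes "prime p" "k dvd p" "k > 1"
  shows "k = p"
  using assms prime_int_iff[of p] by (metis less_imp_le less_irrefl order_less_trans zero_less_one)

lemma coprime_3_int: "\<not> 3 dvd n \<Longrightarrow> coprime n (3::int)"
  using prime_imp_coprime[of "3::int" n] by (simp add: coprime_commute)

lemma odd_square_int:
  fixes a :: int
  assumes "odd a"
  obtains e where "a\<^sup>2 = 1 + 8 * e"
proof -
  obtain j where j: "a = 2 * j + 1" using assms by (elim oddE)
  obtain i where i: "j * (j + 1) = 2 * i"
    using even_mult_iff[of j "j + 1"] by (metis dvdE even_plus_one_iff)
  have "a\<^sup>2 = 1 + 4 * (j * (j + 1))" by (simp add: j power2_eq_square algebra_simps)
  then have "a\<^sup>2 = 1 + 8 * i" by (simp only: i)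
  then show ?thesis by (rule that)
qed

lemma power_add_mult:
  fixes x :: "'a::comm_ring_1"
  shows "\<exists>\<theta>. (x + n * y) ^ k = x ^ k + n * \<theta>"
proof (induction k)
  case 0
  show ?case by (rule exI[of _ 0]) simp
next
  case (Suc k)
  then obtain \<theta> where "(x + n * y) ^ k = x ^ k + n * \<theta>" by blast
  then have "(x + n * y) ^ Suc k = x ^ Suc k + n * (x * \<theta> + y * (x ^ k + n * \<theta>))"
    by (simp add: algebra_simps)
  then show ?case by blast
qed

text \<open>Imaginary part \<open>- 2\<close> forces \<open>m mod 8 = 3\<close>. Then
  \<open>\<beta> ^ (m + 1)\<close> is a power of \<open>\<beta> ^ 4\<close>, which is
  \<open>- (Q^2)\<close> modulo \<open>n\<close>, the real part of \<open>\<beta>^2\<close>.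
  Comparing imaginary parts makes \<open>- 2\<close> a square modulo \<open>n\<close>.\<close>

lemma ip_power_plus_two:
  assumes a: "\<not> 3 dvd a" "odd a" and m: "odd m"
  shows "ip (Zr3 a 2 ^ m) \<noteq> - 2"
proof
  assume eq: "ip (Zr3 a 2 ^ m) = - 2"
  let ?\<beta> = "Zr3 a 2"
  define n where "n = a\<^sup>2 - 12"
  define Q where "Q = a\<^sup>2 + 12"
  obtain e where e: "a\<^sup>2 = 1 + 8 * e" using odd_square_int a(2) by blast
  show False
  proof (cases "\<bar>a\<bar> = 1")
    \<comment> \<open>Here \<open>n\<close> is \<open>- 11\<close>, not a positive modulus, so this
      case is settled modulo 9 instead. For the other \<open>a\<close> the hypotheses give
      \<open>\<bar>a\<bar> \<ge> 5\<close> and thus \<open>n > 0\<close>.\<close>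
    case True
    then have a2: "a\<^sup>2 = 1" by (metis power2_abs power_one)
    obtain \<delta> where \<delta>: "Zr3 a 2 ^ 6 = 1 + 9 * \<delta>"
      using Zr3_power_6[of a 2] a by auto
    obtain t r where tr: "m = 6 * t + r" "r = 1 \<or> r = 3 \<or> r = 5" using odd_decompose_6 m by blast
    have dvd: "9 dvd - 2 - ip (?\<beta> ^ r)"
      using ip_power_6_add[OF \<delta>(1), of t r] eq unfolding tr(1) by simp
    have "a ^ 4 = (a\<^sup>2)\<^sup>2" by simp
    then have "a ^ 4 = 1" using a2 by simp
    then have "ip (?\<beta> ^ r) \<in> {2, - 18, 58}"
      using tr(2) a2 by (elim disjE) (simp_all only: Zr3_power_3 Zr3_power_5 power_one_right zr3.sel, simp_all)
    then show False using dvd by auto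
  next
    case False
    \<comment> \<open>\<open>\<beta>\<^sup>8\<close> is 1 modulo 16, so \<open>m\<close> modulo 8 is determined by the imaginary part modulo 16.\<close>
    have sq: "?\<beta> ^ 2 = Zr3 n (4 * a)"
      by (intro zr3.expand) (simp add: power2_eq_square n_def)
    have "?\<beta> ^ 4 = (?\<beta> ^ 2) ^ 2" by (simp flip: power_mult)
    then have p4: "?\<beta> ^ 4 = Zr3 (n\<^sup>2 - 48 * a\<^sup>2) (8 * a * n)"
      unfolding sq by (auto intro!: zr3.expand simp: power2_eq_square algebra_simps)
    \<comment> \<open>The quadratic equation of \<open>\<beta>^2\<close>, whose trace is
      \<open>2 n\<close> and whose norm is \<open>Q^2\<close>.\<close>
    have rel: "?\<beta> ^ 4 = 2 * of_int n * ?\<beta> ^ 2 - of_int (Q\<^sup>2)"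
      unfolding p4 sq by (auto intro!: zr3.expand simp: n_def Q_def power2_eq_square algebra_simps)
    \<comment> \<open>Chosen so that the real part of \<open>\<beta> ^ 4\<close> is
      \<open>1 + 8 x\<close>, by \<open>a^2 = 1 + 8 e\<close>.\<close>
    define x where "x = 9 - 70 * e + 8 * e\<^sup>2"
    define \<kappa> where "\<kappa> = Zr3 x (a * n)"
    have "(a\<^sup>2)\<^sup>2 = (1 + 8 * e)\<^sup>2" by (simp only: e)
    then have "n\<^sup>2 - 48 * a\<^sup>2 = 1 + 8 * x"
      using e by (simp add: n_def x_def power2_eq_square algebra_simps)
    then have p4': "?\<beta> ^ 4 = 1 + 8 * \<kappa>"
      unfolding p4 by (intro zr3.expand) (simp add: \<kappa>_def)
    have "odd x" "odd n" "odd (a * n)" using a(2) by (simp_all add: x_def n_def)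
    have m4: "m mod 4 = 3 \<and> even (m div 4)"
    proof -
      define k r where "k = m div 4" and "r = m mod 4"
      have m_eq: "m = 4 * k + r" by (simp add: k_def r_def)
      obtain \<theta> where "(1 + 8 * \<kappa>) ^ k = 1 + of_nat k * 8 * \<kappa> + 8\<^sup>2 * \<theta>"
        using power_one_plus_approx by blast
      then have "?\<beta> ^ m = (1 + of_nat k * 8 * \<kappa> + 8\<^sup>2 * \<theta>) * ?\<beta> ^ r"
        by (simp only: m_eq power_add power_mult p4')
      also have "\<dots> = ?\<beta> ^ r + 8 * (of_nat k * (?\<beta> ^ r * \<kappa>) + 8 * (?\<beta> ^ r * \<theta>))"
        by (simp add: algebra_simps)
      finally have im: "- 2 = ip (?\<beta> ^ r) + 8 * (int k * ip (?\<beta> ^ r * \<kappa>) + 8 * ip (?\<beta> ^ r * \<theta>))"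
        using eq by (simp only: zr3_parts zr3_parts_of_nat zr3_parts_numeral) simp
      have "r = 1 \<or> r = 3" using m unfolding r_def by presburger
      moreover have "r \<noteq> 1"
      proof
        assume "r = 1"
        then have "- 2 = 2 + 8 * (int k * ip (?\<beta> ^ r * \<kappa>) + 8 * ip (?\<beta> ^ r * \<theta>))" using im by simp
        moreover have "- 2 \<noteq> 2 + 8 * X" for X :: int by presburger
        ultimately show False by blast
      qed
      ultimately have r3: "r = 3" by blast
      have im3: "ip (?\<beta> ^ r) = 48 * e - 18" unfolding r3 Zr3_power_3 e by simp
      have "rp (?\<beta> ^ r) = a * (a * a) - 36 * a"
        unfolding r3 by (simp add: power3_eq_cube algebra_simps)
      then have "odd (ip (?\<beta> ^ r * \<kappa>))"
        using im3 \<open>odd (a * n)\<close> a(2) by (simp add: \<kappa>_def)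
      moreover have "- 2 = 48 * e - 18 + 8 * (int k * ip (?\<beta> ^ r * \<kappa>) + 8 * ip (?\<beta> ^ r * \<theta>))"
        using im unfolding im3 .
      moreover have "even X" if "- 2 = 48 * e - 18 + 8 * (X + 8 * Y)" for X Y :: int
        using that by presburger
      ultimately have "even (int k * ip (?\<beta> ^ r * \<kappa>))" "odd (ip (?\<beta> ^ r * \<kappa>))" by blast+
      then have "even k" by (simp del: zr3_parts)
      then show ?thesis using r3 by (simp add: k_def r_def)
    qed
    define k where "k = m div 4"
    have k: "m = 4 * k + 3" "even k" using m4 by (simp_all add: k_def) presburger
    define C :: zr3 where "C = of_int (- (Q\<^sup>2))"
    have "?\<beta> ^ 4 = C + of_int n * (2 * ?\<beta> ^ 2)" unfolding rel C_def by simp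
    then obtain \<theta> where \<theta>: "(?\<beta> ^ 4) ^ Suc k = C ^ Suc k + of_int n * \<theta>"
      using power_add_mult by metis
    \<comment> \<open>\<open>E\<close> is \<open>Q ^ (2 k + 2)\<close>. Evenness of \<open>k\<close>
      makes the exponent \<open>Suc k\<close> odd, hence the minus sign in the next line.\<close>
    define E where "E = Q * Q ^ (2 * k + 1)"
    have "(- (Q\<^sup>2)) ^ Suc k = - E"
      using k(2) by (simp add: E_def power_mult power2_eq_square)
    then have CQ: "C ^ Suc k = of_int (- E)"
      unfolding C_def of_int_power[symmetric] by simp
    \<comment> \<open>The exponent \<open>4 * Suc k\<close> is \<open>m + 1\<close>; the conjugate
      absorbs the extra \<open>\<beta>\<close> at the cost of the factor \<open>Q\<close>.\<close>
    have "zcnj ?\<beta> * (?\<beta> ^ 4) ^ Suc k = (?\<beta> * zcnj ?\<beta>) * ?\<beta> ^ m"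
      by (simp add: k(1) power_add power_mult power_numeral_reduce algebra_simps)
    also have "?\<beta> * zcnj ?\<beta> = of_int Q" unfolding mult_zcnj by (simp add: znorm_def Q_def)
    finally have "of_int Q * ?\<beta> ^ m = zcnj ?\<beta> * C ^ Suc k + of_int n * (zcnj ?\<beta> * \<theta>)"
      unfolding \<theta> by (simp add: algebra_simps)
    then have "ip (of_int Q * ?\<beta> ^ m) = ip (zcnj ?\<beta> * C ^ Suc k + of_int n * (zcnj ?\<beta> * \<theta>))"
      by simp
    then have "Q * (- 2) = 2 * E + n * ip (zcnj ?\<beta> * \<theta>)"
      unfolding CQ using eq by simp
    then have "(- 2 * Q) * (Q ^ (2 * k + 1) + 1) = n * ip (zcnj ?\<beta> * \<theta>)"
      unfolding E_def by (simp add: algebra_simps)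
    then have dvd: "n dvd (- 2 * Q) * (Q ^ (2 * k + 1) + 1)" by simp
    have "3 dvd a\<^sup>2 - 1" using a(1) by (rule three_dvd_square_minus_1)
    then have "\<not> 3 dvd n" unfolding n_def by presburger
    have c2: "coprime n 2" using \<open>odd n\<close> by simp
    have c3: "coprime n 3" using \<open>\<not> 3 dvd n\<close> by (rule coprime_3_int)
    have "coprime n (2 * 2 * 2 * 3)" using c2 c3 by (simp only: coprime_mult_right_iff)
    then have "coprime n (n + 24)" by (simp add: coprime_iff_gcd_eq_1)
    then have cQ: "coprime n Q" by (simp add: n_def Q_def add.commute)
    have "coprime n (- 2 * Q)" using c2 cQ by simp
    then have "n dvd Q ^ (2 * k + 1) + 1" using dvd by (simp only: coprime_dvd_mult_right_iff)
    \<comment> \<open>Hence \<open>- Q\<close> is a square modulo \<open>n\<close>. As \<open>Q\<close> is congruent to \<open>2 a\<^sup>2\<close>, so is \<open>- 2\<close>, against \<open>n mod 8 = 5\<close>.\<close>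
    then have "n dvd Q * (Q ^ (2 * k + 1) + 1) + n" by simp
    also have "Q * (Q ^ (2 * k + 1) + 1) + n = (Q ^ (k + 1))\<^sup>2 + (Q + n)"
      unfolding mult_2 power_add power2_eq_square by (simp add: algebra_simps)
    also have "Q + n = 2 * a\<^sup>2" by (simp add: n_def Q_def)
    finally have w: "n dvd (Q ^ (k + 1))\<^sup>2 + 2 * a\<^sup>2" .
    have "coprime a (2 * 2 * 3)"
      using a coprime_3_int by (simp only: coprime_mult_right_iff) simp
    moreover have "l dvd 2 * 2 * 3" if "l dvd a" "l dvd a * a - 12" for l
      using dvd_diff[OF dvd_mult[OF that(1), of a] that(2)] by simp
    ultimately have "coprime a (a * a - 12)" by (metis coprime_def)
    then have "coprime a n" by (simp add: n_def power2_eq_square)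
    then obtain c where "[a * c = 1] (mod n)" using cong_solve_coprime_int by blast
    then have c: "n dvd a * c - 1" by (simp add: cong_iff_dvd_diff)
    have "(Q ^ (k + 1) * c)\<^sup>2 + 2 = c\<^sup>2 * ((Q ^ (k + 1))\<^sup>2 + 2 * a\<^sup>2) - 2 * (a * c + 1) * (a * c - 1)"
      by (simp add: power2_eq_square algebra_simps)
    then have "n dvd (Q ^ (k + 1) * c)\<^sup>2 + 2" using w c by simp
    moreover have "n mod 8 = 5" using e unfolding n_def by presburger
    moreover have "n > 0"
    proof -
      have "\<bar>a\<bar> \<ge> 5" using False a by presburger
      then have "5\<^sup>2 \<le> a\<^sup>2" by (metis abs_le_square_iff abs_numeral)
      then show ?thesis by (simp add: n_def)
    qed
    ultimately show False using not_dvd_square_plus_two by blast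
  qed
qed

text \<open>The imaginary part of \<open>\<beta>\<close> divides 1, so it is 1 and \<open>a\<close>
  is even. An even \<open>m\<close> would make the imaginary part of \<open>\<beta> ^ m\<close>
  even. For odd \<open>m\<close>, \<open>\<beta>^2\<close> being 1 modulo 4 fixes the sign, and
  \<open>ip_power_eq_imp\<close> applies.\<close>

lemma square_plus_3_prime_power:
  fixes p x :: int
  assumes p: "prime p" "odd p" "p \<noteq> 3" and eq: "x\<^sup>2 + 3 = p ^ m" and m: "m > 0"
  shows "m = 1"
proof -
  have "\<not> p dvd 1" using p(1) by auto
  then obtain \<beta> where \<beta>: "znorm \<beta> = p" "ip \<beta> > 0" "\<bar>ip (\<beta> ^ m)\<bar> = 1"
    using prime_power_representation[of p 1 x m] p m eq by auto
  define a where "a = rp \<beta>"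
  have "ip \<beta> dvd 1" using ip_dvd_ip_power[of \<beta> m] \<beta>(3) by (metis dvd_abs_iff)
  then have "ip \<beta> = 1" using \<beta>(2) by simp
  then have \<beta>_eq: "\<beta> = Zr3 a 1" by (simp add: a_def zr3.expand)
  have pa: "p = a\<^sup>2 + 3" using \<beta>(1) by (simp add: \<beta>_eq znorm_def)
  have "even a" using pa p(2) by simp
  have "\<not> 3 dvd a"
  proof
    assume "3 dvd a"
    then have "3 dvd p" unfolding pa by (simp add: power2_eq_square)
    then show False using prime_int_dvdD[of p 3] p by simp
  qed
  have "odd m"
  proof
    assume "even m"
    then obtain k where "m = k * 2" by (metis dvd_div_mult_self)
    then have "\<beta> ^ m = \<beta> ^ k * \<beta> ^ k" by (simp add: power_mult power2_eq_square)
    then have "ip (\<beta> ^ m) = 2 * (rp (\<beta> ^ k) * ip (\<beta> ^ k))" by simp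
    then show False using \<beta>(3) by presburger
  qed
  then obtain k where k: "m = 2 * k + 1" by (blast elim: oddE)
  obtain c where "a = 2 * c" using \<open>even a\<close> by blast
  then have "\<beta> ^ 2 = 1 + 4 * Zr3 (c\<^sup>2 - 1) c"
    by (intro zr3.expand) (simp add: \<beta>_eq power2_eq_square)
  then obtain \<theta> where "(\<beta> ^ 2) ^ k = 1 + of_nat k * 4 * Zr3 (c\<^sup>2 - 1) c + 4\<^sup>2 * \<theta>"
    using power_one_plus_approx by metis
  then have "\<beta> ^ m = (1 + of_nat k * 4 * Zr3 (c\<^sup>2 - 1) c + 4\<^sup>2 * \<theta>) * \<beta>"
    by (simp only: k power_add power_mult power_one_right)
  also have "\<dots> = \<beta> + 4 * (\<beta> * (of_nat k * Zr3 (c\<^sup>2 - 1) c + 4 * \<theta>))"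
    by (simp add: algebra_simps)
  finally have "ip (\<beta> ^ m) = 1 + 4 * ip (\<beta> * (of_nat k * Zr3 (c\<^sup>2 - 1) c + 4 * \<theta>))"
    by (simp add: \<beta>_eq)
  then have "ip (Zr3 a 1 ^ m) = 1" using \<beta>(3) unfolding \<beta>_eq by presburger
  then show ?thesis using ip_power_eq_imp[of a 1 m] \<open>odd m\<close> \<open>\<not> 3 dvd a\<close> by simp
qed

text \<open>An even \<open>m\<close> would give \<open>\<beta> ^ (m div 2)\<close> two odd
  coordinates, hence an even norm, although \<open>p\<close> is odd. For odd \<open>m\<close>,
  \<open>b = 1\<close> would keep the imaginary part odd; so \<open>b = 2\<close>, and
  \<open>ip_power_plus_two\<close> rules out the minus sign.\<close>

lemma square_plus_12_prime_power:
  fixes p x :: int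
  assumes p: "prime p" "odd p" "p \<noteq> 3" and eq: "x\<^sup>2 + 12 = p ^ m" and m: "m > 0"
  shows "m = 1"
proof -
  have "\<not> p dvd 2"
  proof
    assume "p dvd 2"
    then have "p \<le> 2" by (rule zdvd_imp_le) simp
    moreover have "p > 1" using p(1) by (rule prime_gt_1_int)
    ultimately have "p = 2" by simp
    then show False using p(2) by simp
  qed
  then obtain \<beta> where \<beta>: "znorm \<beta> = p" "ip \<beta> > 0" "\<bar>ip (\<beta> ^ m)\<bar> = 2"
    using prime_power_representation[of p 2 x m] p m eq by auto
  define a where "a = rp \<beta>"
  define b where "b = ip \<beta>"
  have "b dvd 2" using ip_dvd_ip_power[of \<beta> m] \<beta>(3) unfolding b_def by (metis dvd_abs_iff)
  then have "b \<le> 2" by (auto dest: zdvd_imp_le)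
  then have b: "b = 1 \<or> b = 2" using \<beta>(2) by (auto simp: b_def)
  have \<beta>_eq: "\<beta> = Zr3 a b" by (simp add: a_def b_def zr3.expand)
  have pa: "p = a\<^sup>2 + 3 * b\<^sup>2" using \<beta>(1) by (simp add: \<beta>_eq znorm_def)
  have "\<not> 3 dvd a"
  proof
    assume "3 dvd a"
    then have "3 dvd p" unfolding pa by (simp add: power2_eq_square)
    then show False using prime_int_dvdD[of p 3] p by simp
  qed
  have "odd m"
  proof
    assume "even m"
    then obtain k where k: "m = k * 2" by (metis dvd_div_mult_self)
    then have "\<beta> ^ m = \<beta> ^ k * \<beta> ^ k" by (simp add: power_mult power2_eq_square)
    then have "ip (\<beta> ^ m) = 2 * (rp (\<beta> ^ k) * ip (\<beta> ^ k))" by simp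
    then have "\<bar>rp (\<beta> ^ k) * ip (\<beta> ^ k)\<bar> = 1" using \<beta>(3) by presburger
    then have "\<bar>rp (\<beta> ^ k)\<bar> = 1 \<and> \<bar>ip (\<beta> ^ k)\<bar> = 1"
      by (metis abs_mult abs_zmult_eq_1 mult.commute abs_abs)
    then have "odd (rp (\<beta> ^ k)) \<and> odd (ip (\<beta> ^ k))" by presburger
    then have "even (znorm (\<beta> ^ k))" by (simp add: znorm_def)
    moreover have "znorm (\<beta> ^ k) = p ^ k"
      by (induction k) (simp_all add: znorm_mult \<beta>(1), simp add: znorm_def)
    ultimately show False using p(2) by simp
  qed
  have "b = 2"
  proof (rule ccontr)
    assume "b \<noteq> 2"
    then have "b = 1" using b by simp
    then have "even a" using pa p(2) by simp
    obtain k where k: "m = 2 * k + 1" using \<open>odd m\<close> by (blast elim: oddE)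
    have "odd (ip (\<beta> ^ (2 * j + 1))) \<and> even (rp (\<beta> ^ (2 * j + 1)))" for j
      by (induction j) (use \<open>even a\<close> \<open>b = 1\<close> in \<open>simp_all add: \<beta>_eq\<close>)
    then show False using k \<beta>(3) by (metis abs_numeral dvd_abs_iff dvd_refl)
  qed
  then have "odd a" using pa p(2) by simp
  have "ip (Zr3 a 2 ^ m) = 2"
    using ip_power_plus_two[of a m] \<open>\<not> 3 dvd a\<close> \<open>odd a\<close> \<open>odd m\<close> \<beta>(3) \<beta>_eq \<open>b = 2\<close> by auto
  then show ?thesis using ip_power_eq_imp[of a 2 m] \<open>odd m\<close> \<open>\<not> 3 dvd a\<close> by simp
qed

section \<open>Arithmetic of the cubic cyclotomic numbers\<close>

text \<open>Multiplying the two forms gives \<open>16 q^2 = X^2 + 27 Y^2\<close>, where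
  \<open>Y\<close> is a multiple of \<open>q\<close> for one choice of the sign of
  \<open>d'\<close>. Since \<open>27 > 16\<close>, \<open>Y = 0\<close>, and the representations are
  proportional.\<close>

lemma four_times_prime_unique:
  fixes q c d c' d' :: int
  assumes q: "prime q" and eq: "4 * q = c\<^sup>2 + 27 * d\<^sup>2" and eq': "4 * q = c'\<^sup>2 + 27 * d'\<^sup>2"
  shows "c\<^sup>2 = c'\<^sup>2 \<and> d\<^sup>2 = d'\<^sup>2"
proof -
  have q0: "q > 0" using q by (rule prime_gt_0_int)
  have *: "c\<^sup>2 = c'\<^sup>2 \<and> d\<^sup>2 = d'\<^sup>2" if dvd: "q dvd c * e - c' * d" and e: "e\<^sup>2 = d'\<^sup>2" for e
  proof -
    obtain k where k: "c * e - c' * d = q * k" using dvd by blast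
    have "(c * c' + 27 * d * e)\<^sup>2 + 27 * (c * e - c' * d)\<^sup>2 = (c\<^sup>2 + 27 * d\<^sup>2) * (c'\<^sup>2 + 27 * e\<^sup>2)"
      by (simp add: power2_eq_square algebra_simps)
    also have "\<dots> = 16 * q\<^sup>2" unfolding e eq[symmetric] eq'[symmetric] by (simp add: power2_eq_square)
    finally have "27 * (c * e - c' * d)\<^sup>2 \<le> 16 * q\<^sup>2"
      by (metis le_add_same_cancel2 zero_le_power2)
    then have "q\<^sup>2 * (27 * k\<^sup>2) \<le> q\<^sup>2 * 16" unfolding k by (simp add: power_mult_distrib algebra_simps)
    then have "27 * k\<^sup>2 \<le> 16" using q0 by simp
    then have "k = 0" by (rule_tac ccontr) (auto dest: zero_less_power2[THEN iffD2])
    then have "c * e = c' * d" using k by simp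
    then have "c\<^sup>2 * d'\<^sup>2 = c'\<^sup>2 * d\<^sup>2" using e by (metis power_mult_distrib)
    moreover have "4 * q * (d'\<^sup>2 - d\<^sup>2) = (c\<^sup>2 + 27 * d\<^sup>2) * d'\<^sup>2 - (c'\<^sup>2 + 27 * d'\<^sup>2) * d\<^sup>2"
      unfolding eq[symmetric] eq'[symmetric] by (simp add: algebra_simps)
    ultimately have "4 * q * (d'\<^sup>2 - d\<^sup>2) = 0" by (simp add: algebra_simps)
    then have "d\<^sup>2 = d'\<^sup>2" using q0 by simp
    then show ?thesis using eq eq' by simp
  qed
  \<comment> \<open>Divisibility of this product by the prime \<open>q\<close> decides the sign of
    \<open>d'\<close>.\<close>
  have "(c * d' - c' * d) * (c * d' - c' * (- d)) = c\<^sup>2 * d'\<^sup>2 - c'\<^sup>2 * d\<^sup>2"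
    by (simp add: power2_eq_square algebra_simps)
  also have "\<dots> = (c\<^sup>2 + 27 * d\<^sup>2) * d'\<^sup>2 - (c'\<^sup>2 + 27 * d'\<^sup>2) * d\<^sup>2"
    by (simp add: algebra_simps)
  also have "\<dots> = q * (4 * (d'\<^sup>2 - d\<^sup>2))"
    unfolding eq[symmetric] eq'[symmetric] by (simp add: algebra_simps)
  finally have "q dvd (c * d' - c' * d) * (c * d' - c' * (- d))" by simp
  then consider "q dvd c * d' - c' * d" | "q dvd c * (- d') - c' * d"
    using q by (auto simp: prime_dvd_mult_iff) (metis add.commute dvd_minus_iff minus_add_distrib minus_diff_eq mult_minus_right uminus_add_conv_diff)
  then show ?thesis using *[of d'] *[of "- d'"] by cases auto
qed

lemma odd_dvd_power_2:
  fixes k :: int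
  assumes "odd k" "k > 0" "k dvd 2 ^ m"
  shows "k = 1"
proof -
  have "coprime k (2 ^ m)" using assms(1) by simp
  then show ?thesis using assms(2,3) by (metis abs_of_pos coprime_absorb_left zdvd1_eq)
qed

text \<open>For \<open>p = 2\<close> the right side is 4 times an odd number, so it is 4, which is
  the excluded \<open>e = 0\<close>. Odd \<open>p\<close> is the theorem on prime powers
  above.\<close>

lemma primepow_square_plus_3:
  fixes q :: nat and e :: int
  assumes q: "primepow q" "\<not> 3 dvd q" and eq: "int q = (3 * e - 1)\<^sup>2 + 3" and e: "e \<noteq> 0"
  shows "prime q"
proof -
  obtain p m where pm: "prime p" "m > 0" "q = p ^ m" using q(1) by (auto simp: primepow_def)
  have ip: "int q = int p ^ m" by (simp add: pm(3))
  have "p \<noteq> 2"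
  proof
    assume p2: "p = 2"
    then have "even q" using pm by simp
    then have "odd (3 * e - 1)" using eq by (metis even_of_nat dvd_add_right_iff even_power odd_numeral even_add zero_less_numeral)
    then obtain i where i: "(3 * e - 1)\<^sup>2 = 1 + 8 * i" using odd_square_int by blast
    then have q4: "int q = 4 * (1 + 2 * i)" using eq by simp
    then have "1 + 2 * i dvd 2 ^ m" using ip p2 by (metis dvd_triv_right of_nat_numeral)
    moreover have "1 + 2 * i > 0" using q4 q(1) primepow_gt_0_nat[of q] by simp
    ultimately have "1 + 2 * i = 1" using odd_dvd_power_2[of "1 + 2 * i" m] by simp
    then have "(3 * e - 1)\<^sup>2 = 1" using i by simp
    then have "3 * e - 1 = 1 \<or> 3 * e - 1 = - 1" by (simp add: power2_eq_1_iff)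
    then show False using e by presburger
  qed
  moreover have "p \<noteq> 3" using q(2) pm by auto
  ultimately have "m = 1"
    using square_plus_3_prime_power[of "int p" "3 * e - 1" m] pm eq ip prime_odd_nat[of p] prime_ge_2_nat[of p]
    by auto
  then show ?thesis using pm by simp
qed

text \<open>For \<open>p = 2\<close> the right side is \<open>4 (y^2 + 3)\<close>; an even
  \<open>y\<close> gives an odd factor above 1, and an odd \<open>y\<close> leaves only 16, the
  excluded \<open>e = 0\<close>.\<close>

lemma primepow_square_plus_12:
  fixes q :: nat and e :: int
  assumes q: "primepow q" "\<not> 3 dvd q" and eq: "int q = (3 * e + 2)\<^sup>2 + 12" and e: "e \<noteq> 0"
  shows "prime q"
proof -
  obtain p m where pm: "prime p" "m > 0" "q = p ^ m" using q(1) by (auto simp: primepow_def)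
  have ip: "int q = int p ^ m" by (simp add: pm(3))
  have "p \<noteq> 2"
  proof
    assume p2: "p = 2"
    then have "even q" using pm by simp
    then have "even (3 * e + 2)" using eq by (metis even_of_nat even_add even_numeral even_power)
    then obtain y where y: "3 * e + 2 = 2 * y" by blast
    have q4: "int q = 4 * (y\<^sup>2 + 3)" using eq unfolding y by (simp add: power2_eq_square)
    have "y\<^sup>2 + 3 > 0" by (simp add: add_nonneg_pos)
    have "y\<^sup>2 + 3 dvd 2 ^ m" using ip p2 q4 by (metis dvd_triv_right of_nat_numeral)
    have "odd y"
    proof
      assume "even y"
      then have "y\<^sup>2 + 3 = 1" using odd_dvd_power_2[of "y\<^sup>2 + 3" m] \<open>y\<^sup>2 + 3 dvd 2 ^ m\<close> \<open>y\<^sup>2 + 3 > 0\<close> by simp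
      moreover have "y\<^sup>2 \<ge> 0" by simp
      ultimately show False by linarith
    qed
    then obtain i where i: "y\<^sup>2 = 1 + 8 * i" using odd_square_int by blast
    then have "y\<^sup>2 + 3 = 4 * (1 + 2 * i)" by simp
    then have "1 + 2 * i dvd 2 ^ m" "1 + 2 * i > 0"
      using \<open>y\<^sup>2 + 3 dvd 2 ^ m\<close> \<open>y\<^sup>2 + 3 > 0\<close> by (metis dvd_mult_right, simp)
    then have "1 + 2 * i = 1" using odd_dvd_power_2[of "1 + 2 * i" m] by simp
    then have "y\<^sup>2 = 1" using i by simp
    then have "y = 1 \<or> y = - 1" by (simp add: power2_eq_1_iff)
    then show False using e y by presburger
  qed
  moreover have "p \<noteq> 3" using q(2) pm by auto
  ultimately have "m = 1"
    using square_plus_12_prime_power[of "int p" "3 * e + 2" m] pm eq ip prime_odd_nat[of p] prime_ge_2_nat[of p]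
    by auto
  then show ?thesis using pm by simp
qed

text \<open>Collects what the arithmetic needs from the scheme: \<open>f\<close> is the size of a
  class, \<open>sum\<close> counts the neighbours of a vertex by class, and \<open>quad\<close>
  comes from associativity. The relations are symmetric in \<open>B\<close> and \<open>C\<close>, so
  each coincidence is treated for \<open>B\<close> only.\<close>

locale cyclotomic_numbers =
  fixes q :: nat and A B C f :: int
  assumes primepow: "primepow q" and q: "int q = 3 * f + 1"
    and sum: "A + B + C = f - 1"
    and quad: "A * (A + 1) + B\<^sup>2 + C\<^sup>2 = B * C + (A + 1) * (B + C)"
begin

definition c where "c = 9 * A - int q + 8"
definition d where "d = C - B"

lemma norm_form: "4 * int q = c\<^sup>2 + 27 * d\<^sup>2"
proof -
  have f: "f = A + B + C + 1" using sum by simp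
  show ?thesis using quad unfolding c_def d_def q f by (simp add: power2_eq_square algebra_simps)
qed

text \<open>Fixes the sign of \<open>c\<close>, which uniqueness of the representation determines
  only up to sign.\<close>

lemma c_mod_3: "3 dvd c - 1"
  unfolding c_def q by presburger

lemma A_c: "9 * A = int q - 8 + c" and B_c: "18 * B = 2 * int q - 4 - c - 9 * d"
  and C_c: "18 * C = 2 * int q - 4 - c + 9 * d"
  using sum unfolding c_def d_def q by simp_all

lemma not_3_dvd: "\<not> 3 dvd q"
  using q by presburger

lemma swap: "cyclotomic_numbers q A C B f"
  using primepow q sum quad by unfold_locales (simp_all add: algebra_simps)

lemma square_plus_3_forward:
  assumes "A = B" "B \<noteq> C"
  shows "prime q \<and> (\<exists>x. int q = x\<^sup>2 + 3)"
proof -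
  have c: "c = 4 - 3 * d" using assms(1) A_c B_c by simp
  have "4 * int q = 4 * ((3 * d - 1)\<^sup>2 + 3)"
    using norm_form unfolding c by (simp add: power2_eq_square algebra_simps)
  then have "int q = (3 * d - 1)\<^sup>2 + 3" by simp
  moreover have "d \<noteq> 0" using assms(2) by (simp add: d_def)
  ultimately show ?thesis using primepow_square_plus_3 primepow not_3_dvd by blast
qed

lemma square_plus_12_forward:
  assumes "A + 2 = B" "B \<noteq> C"
  shows "prime q \<and> (\<exists>x. int q = x\<^sup>2 + 12)"
proof -
  have c: "c = - 8 - 3 * d" using assms(1) A_c B_c by simp
  have "4 * int q = 4 * ((3 * d + 2)\<^sup>2 + 12)"
    using norm_form unfolding c by (simp add: power2_eq_square algebra_simps)
  then have "int q = (3 * d + 2)\<^sup>2 + 12" by simp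
  moreover have "d \<noteq> 0" using assms(2) by (simp add: d_def)
  ultimately show ?thesis using primepow_square_plus_12 primepow not_3_dvd by blast
qed

lemma norm_form_unique:
  assumes "prime q" "4 * int q = c'\<^sup>2 + 27 * e\<^sup>2" "3 dvd c' - 1"
  shows "c = c' \<and> (d = e \<or> d = - e)"
proof -
  have "c\<^sup>2 = c'\<^sup>2 \<and> d\<^sup>2 = e\<^sup>2"
    using four_times_prime_unique[of "int q" c d c' e] assms norm_form by simp
  then have "c = c' \<or> c = - c'" "d = e \<or> d = - e" by (simp_all add: power2_eq_iff)
  moreover have "c \<noteq> - c'" using c_mod_3 assms(3) by presburger
  ultimately show ?thesis by blast
qed

text \<open>Writing \<open>x\<close> as \<open>3 e - 1\<close> up to sign exhibits the
  representation \<open>(4 - 3 e, e)\<close> of \<open>4 q\<close>. Uniqueness then gives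
  \<open>A = e (e - 1)\<close>, while \<open>B\<close> and \<open>C\<close> are
  \<open>e (e - 1)\<close> and \<open>e^2\<close> in some order.\<close>

lemma square_plus_3_backward:
  assumes "prime q" "int q = x\<^sup>2 + 3" "q \<noteq> 7"
  shows "(A = B \<or> A = C) \<and> B \<noteq> C \<and> B > 0 \<and> C > 0"
proof -
  have "\<not> 3 dvd x"
  proof
    assume "3 dvd x"
    then have "3 dvd x\<^sup>2" by (simp add: power2_eq_square)
    then show False using assms(2) q by presburger
  qed
  then have "x mod 3 = 1 \<or> x mod 3 = 2" by presburger
  then obtain e where e: "x = 3 * e - 1 \<or> x = - (3 * e - 1)"
  proof
    assume "x mod 3 = 1"
    then have "x = - (3 * (- (x div 3)) - 1)" by presburger
    then show ?thesis using that by blast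
  next
    assume "x mod 3 = 2"
    then have "x = 3 * (x div 3 + 1) - 1" by presburger
    then show ?thesis using that by blast
  qed
  then have qe: "int q = (3 * e - 1)\<^sup>2 + 3" using assms(2) by (metis power2_minus)
  have "4 * int q = (4 - 3 * e)\<^sup>2 + 27 * e\<^sup>2"
    unfolding qe by (simp add: power2_eq_square algebra_simps)
  moreover have "3 dvd (4 - 3 * e) - 1" by presburger
  ultimately have cd: "c = 4 - 3 * e" "d = e \<or> d = - e" using norm_form_unique assms(1) by blast+
  have "e \<noteq> 0"
  proof
    assume "e = 0"
    then have "q = 2 * 2" using qe by simp
    then show False using assms(1) by (metis prime_product Suc_1 nat.simps(1) one_neq_zero zero_neq_numeral numeral_eq_one_iff semiring_norm(85))
  qed
  \<comment> \<open>\<open>e = 1\<close> is \<open>q = 7\<close>, where \<open>e (e - 1)\<close>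
    vanishes and positivity fails.\<close>
  have "e \<noteq> 1" using assms(3) qe by auto
  have "e * e > 0" using \<open>e \<noteq> 0\<close> by (simp add: zero_less_mult_iff) linarith
  have "e * (e - 1) > 0" using \<open>e \<noteq> 0\<close> \<open>e \<noteq> 1\<close> by (simp add: zero_less_mult_iff) linarith
  have "9 * A = 9 * (e * (e - 1))" using A_c unfolding cd(1) qe by (simp add: power2_eq_square algebra_simps)
  moreover have "(18 * B = 18 * (e * (e - 1)) \<and> 18 * C = 18 * (e * e)) \<or> (18 * C = 18 * (e * (e - 1)) \<and> 18 * B = 18 * (e * e))"
    using cd(2) B_c C_c unfolding cd(1) qe by (auto simp: power2_eq_square algebra_simps)
  moreover have "e * (e - 1) \<noteq> e * e" using \<open>e \<noteq> 0\<close> by simp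
  ultimately show ?thesis using \<open>e * e > 0\<close> \<open>e * (e - 1) > 0\<close> by auto
qed

text \<open>With \<open>x = 3 e + 2\<close> up to sign, \<open>(- 8 - 3 e, e)\<close> represents
  \<open>4 q\<close>. The degenerate \<open>e = 0\<close> would be \<open>q = 16\<close>, which is
  not prime.\<close>

lemma square_plus_12_backward:
  assumes "prime q" "int q = x\<^sup>2 + 12"
  shows "(A + 2 = B \<or> A + 2 = C) \<and> B \<noteq> C"
proof -
  have "\<not> 3 dvd x"
  proof
    assume "3 dvd x"
    then have "3 dvd x\<^sup>2" by (simp add: power2_eq_square)
    then show False using assms(2) q by presburger
  qed
  then have "x mod 3 = 1 \<or> x mod 3 = 2" by presburger
  then obtain e where e: "x = 3 * e + 2 \<or> x = - (3 * e + 2)"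
  proof
    assume "x mod 3 = 1"
    then have "x = - (3 * (- (x div 3) - 1) + 2)" by presburger
    then show ?thesis using that by blast
  next
    assume "x mod 3 = 2"
    then have "x = 3 * (x div 3) + 2" by presburger
    then show ?thesis using that by blast
  qed
  then have qe: "int q = (3 * e + 2)\<^sup>2 + 12" using assms(2) by (metis power2_minus)
  have "4 * int q = (- 8 - 3 * e)\<^sup>2 + 27 * e\<^sup>2"
    unfolding qe by (simp add: power2_eq_square algebra_simps)
  moreover have "3 dvd (- 8 - 3 * e) - 1" by presburger
  ultimately have cd: "c = - 8 - 3 * e" "d = e \<or> d = - e" using norm_form_unique assms(1) by blast+
  have "e \<noteq> 0"
  proof
    assume "e = 0"
    then have "q = 4 * 4" using qe by simp
    then show False using assms(1) by (metis prime_product numeral_eq_one_iff semiring_norm(85) semiring_norm(83))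
  qed
  have "B \<noteq> C" using cd(2) \<open>e \<noteq> 0\<close> unfolding d_def by auto
  moreover have "A + 2 = B \<or> A + 2 = C"
    using cd(2) A_c B_c C_c unfolding cd(1) by auto
  ultimately show ?thesis by blast
qed

end

section \<open>Deza graphs among Cayley graphs\<close>

lemma Cay_simps [simp]: "pverts (Cay T) = UNIV" "(x, y) \<in> parcs (Cay T) \<longleftrightarrow> x - y \<in> T"
  by (simp_all add: Cay_def)

lemma connection_set_uminus:
  fixes T :: "'g::group_add set"
  assumes "connection_set T"
  shows "- x \<in> T \<longleftrightarrow> x \<in> T"
  using assms unfolding connection_set_def by (metis imageI minus_minus)

lemma connection_set_minus:
  fixes T :: "'g::group_add set"
  assumes "connection_set T"
  shows "x - y \<in> T \<longleftrightarrow> y - x \<in> T"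
  using connection_set_uminus[OF assms, of "x - y"] by simp

lemma pair_graph_Cay:
  fixes T :: "'g::{group_add, finite} set"
  assumes "connection_set T"
  shows "pair_graph (Cay T)"
proof unfold_locales
  show "symmetric (with_proj (Cay T))"
    unfolding symmetric_def
    by (rule symI) (simp, simp only: connection_set_minus[OF assms])
next
  fix e assume "e \<in> parcs (Cay T)"
  then show "fst e \<noteq> snd e" using assms by (cases e) (auto simp: connection_set_def)
qed auto

lemma regular_Cay:
  fixes T :: "'g::{ab_group_add, finite} set"
  shows "regular_graph (Cay T) k \<longleftrightarrow> k = card T"
proof -
  have "out_degree (with_proj (Cay T)) v = card T" for v
  proof -
    have "out_arcs (with_proj (Cay T)) v = (\<lambda>t. (v, - t + v)) ` T"
    proof (intro set_eqI iffI)
      fix e assume "e \<in> out_arcs (with_proj (Cay T)) v"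
      then obtain y where e: "e = (v, y)" "v - y \<in> T" by (cases e) (auto simp: out_arcs_def)
      have "y = - (v - y) + v" by simp
      then show "e \<in> (\<lambda>t. (v, - t + v)) ` T" using e by blast
    qed (auto simp: out_arcs_def)
    moreover have "inj_on (\<lambda>t. (v, - t + v)) T" by (auto intro: inj_onI)
    ultimately show ?thesis by (simp add: out_degree_def card_image)
  qed
  then show ?thesis by (auto simp: regular_graph_def)
qed

text \<open>Sums instead of differences, so that the count is the convolution square of the
  indicator of \<open>T\<close>; for a connection set both give the number of common
  neighbours.\<close>

definition sum_count :: "'g::ab_group_add set \<Rightarrow> 'g \<Rightarrow> nat" where
  "sum_count T z = card {y \<in> T. z - y \<in> T}"

lemma card_common_neighbours_Cay:
  fixes T :: "'g::{ab_group_add, finite} set"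
  assumes "connection_set T"
  shows "card (common_neighbours (Cay T) u v) = sum_count T (u - v)"
  unfolding sum_count_def
proof (rule bij_betw_same_card)
  show "bij_betw (\<lambda>w. u - w) (common_neighbours (Cay T) u v) {y \<in> T. u - v - y \<in> T}"
  proof (rule bij_betw_byWitness[where f' = "\<lambda>y. u - y"])
    show "(\<lambda>w. u - w) ` common_neighbours (Cay T) u v \<subseteq> {y \<in> T. u - v - y \<in> T}"
    proof
      fix y assume "y \<in> (\<lambda>w. u - w) ` common_neighbours (Cay T) u v"
      then obtain w where w: "y = u - w" "u - w \<in> T" "v - w \<in> T"
        by (auto simp: common_neighbours_def)
      have "u - v - y = w - v" by (simp add: w(1))
      then show "y \<in> {y \<in> T. u - v - y \<in> T}"
        using w connection_set_minus[OF assms, of w v] by simp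
    qed
    show "(\<lambda>y. u - y) ` {y \<in> T. u - v - y \<in> T} \<subseteq> common_neighbours (Cay T) u v"
    proof
      fix w assume "w \<in> (\<lambda>y. u - y) ` {y \<in> T. u - v - y \<in> T}"
      then obtain y where y: "w = u - y" "y \<in> T" "u - v - y \<in> T" by blast
      have "w - v = u - v - y" by (simp add: y(1))
      then have "v - w \<in> T" using y(3) connection_set_minus[OF assms, of w v] by metis
      then show "w \<in> common_neighbours (Cay T) u v"
        using y by (simp add: common_neighbours_def)
    qed
  qed simp_all
qed

text \<open>With unit costs the cost of a walk is its length. A common neighbour supplies a walk of
  length 2, and the pair \<open>u0\<close>, \<open>v0\<close> admits no shorter one.\<close>

lemma graph_diameter_2I:
  assumes G: "pair_graph G"
    and far: "u0 \<in> pverts G" "v0 \<in> pverts G" "u0 \<noteq> v0" "(u0, v0) \<notin> parcs G"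
    and near: "\<And>u v. u \<in> pverts G \<Longrightarrow> v \<in> pverts G \<Longrightarrow> u \<noteq> v \<Longrightarrow> (u, v) \<notin> parcs G \<Longrightarrow>
      common_neighbours G u v \<noteq> {}"
  shows "graph_diameter G = 2"
proof -
  interpret pair_graph G by fact
  have cost: "awalk_cost (\<lambda>_. 1) p = length p" for p :: "('a \<times> 'a) list"
    by (induction p) auto
  have le: "\<mu> (\<lambda>_. 1) u v \<le> 2" if uv: "u \<in> pverts G" "v \<in> pverts G" for u v
  proof -
    have "\<exists>p. awalk u p v \<and> length p \<le> 2"
    proof (cases "u = v \<or> (u, v) \<in> parcs G")
      case True
      then show ?thesis
      proof
        assume "u = v"
        then show ?thesis using uv by (intro exI[of _ "[]"]) (simp add: awalk_Nil_iff)
      next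
        assume "(u, v) \<in> parcs G"
        then show ?thesis using uv by (intro exI[of _ "[(u, v)]"]) (simp add: awalk_def)
      qed
    next
      case False
      then obtain w where w: "w \<in> common_neighbours G u v" using near uv by blast
      then have "(u, w) \<in> parcs G" "(w, v) \<in> parcs G"
        using arcs_symmetric by (auto simp: common_neighbours_def)
      then show ?thesis using uv by (intro exI[of _ "[(u, w), (w, v)]"]) (simp add: awalk_def)
    qed
    then obtain p where p: "awalk u p v" "length p \<le> 2" by blast
    have "\<mu> (\<lambda>_. 1) u v \<le> awalk_cost (\<lambda>_. 1) p" using p(1) by (rule min_cost_le_walk_cost)
    also have "\<dots> \<le> 2" using p(2) by (simp add: cost)
    finally show ?thesis .
  qed
  have ge: "2 \<le> \<mu> (\<lambda>_. 1) u0 v0"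
    unfolding \<mu>_def
  proof (rule INF_greatest)
    fix p assume "p \<in> {p. awalk u0 p v0}"
    then have p: "awalk u0 p v0" by simp
    have "length p \<ge> 2"
    proof (rule ccontr)
      assume "\<not> length p \<ge> 2"
      then consider "p = []" | e where "p = [e]"
        by (cases p; cases "tl p") auto
      then show False using p far by cases (auto simp: awalk_def)
    qed
    then show "2 \<le> ereal (awalk_cost (\<lambda>_. 1) p)" by (simp add: cost)
  qed
  show ?thesis
    unfolding graph_diameter_def
  proof (rule antisym)
    show "(SUP u\<in>pverts G. SUP v\<in>pverts G. \<mu> (\<lambda>_. 1) u v) \<le> 2"
      using le by (intro SUP_least)
    show "2 \<le> (SUP u\<in>pverts G. SUP v\<in>pverts G. \<mu> (\<lambda>_. 1) u v)"
      using far ge by (intro SUP_upper2[of u0] SUP_upper2[of v0])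
  qed
qed

text \<open>\<open>z1\<close> and \<open>z2\<close> lie on the same side of adjacency but have
  different counts, which refutes strong regularity; \<open>z0\<close> is at distance at least 2
  from \<open>0\<close>.\<close>

lemma strictly_deza_CayI:
  fixes T :: "'g::{ab_group_add, finite} set"
  assumes T: "connection_set T"
    and vals: "sum_count T ` (UNIV - {0}) = {a, b}"
    and neq: "z1 \<noteq> 0" "z2 \<noteq> 0" "z1 \<in> T \<longleftrightarrow> z2 \<in> T" "sum_count T z1 \<noteq> sum_count T z2"
    and far: "z0 \<notin> T" "z0 \<noteq> 0"
    and pos: "\<And>z. z \<notin> T \<Longrightarrow> z \<noteq> 0 \<Longrightarrow> sum_count T z > 0"
  shows "strictly_deza_graph (Cay T)"
  unfolding strictly_deza_graph_def
proof (intro conjI)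
  note [simp] = card_common_neighbours_Cay[OF T]
  have "{sum_count T (u - v) | u v. u \<noteq> v} = sum_count T ` (UNIV - {0})"
  proof (intro set_eqI iffI)
    fix x assume "x \<in> sum_count T ` (UNIV - {0})"
    then obtain z where "z \<noteq> 0" "x = sum_count T (z - 0)" by auto
    then show "x \<in> {sum_count T (u - v) | u v. u \<noteq> v}" by blast
  qed auto
  moreover have "sum_count T z \<le> card T" for z
    unfolding sum_count_def by (intro card_mono) auto
  then have "max a b \<le> card T" using vals by (metis imageE insertCI max_def)
  moreover have "card T < card (UNIV :: 'g set)"
    using T by (intro psubset_card_mono) (auto simp: connection_set_def)
  moreover have "{a, b} = {min a b, max a b}" by (auto simp: min_def max_def)
  ultimately have "deza_graph (Cay T) (card (UNIV :: 'g set)) (card T) (max a b) (min a b)"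
    using vals pair_graph_Cay[OF T] by (simp add: deza_graph_def regular_Cay)
  then show "\<exists>n k b a. deza_graph (Cay T) n k b a" by blast
  show "graph_diameter (Cay T) = 2"
  proof (rule graph_diameter_2I[of _ z0 0])
    fix u v assume "u \<noteq> v" "(u, v) \<notin> parcs (Cay T)"
    then have "card (common_neighbours (Cay T) u v) > 0" using pos by simp
    then show "common_neighbours (Cay T) u v \<noteq> {}" by (metis card.empty less_irrefl)
  qed (use far pair_graph_Cay[OF T] in auto)
  show "\<not> (\<exists>n k l m. strongly_regular (Cay T) n k l m)"
  proof
    assume "\<exists>n k l m. strongly_regular (Cay T) n k l m"
    then obtain l m where "\<And>u v. u - v \<in> T \<Longrightarrow> sum_count T (u - v) = l"
      "\<And>u v. u \<noteq> v \<Longrightarrow> u - v \<notin> T \<Longrightarrow> sum_count T (u - v) = m"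
      by (auto simp: strongly_regular_def)
    from this[of _ 0] have "\<And>z. z \<in> T \<Longrightarrow> sum_count T z = l"
      "\<And>z. z \<noteq> 0 \<Longrightarrow> z \<notin> T \<Longrightarrow> sum_count T z = m" by simp_all
    then show False using neq by metis
  qed
qed

lemma strictly_deza_CayD:
  fixes T :: "'g::{ab_group_add, finite} set"
  assumes T: "connection_set T" and deza: "strictly_deza_graph (Cay T)"
  shows "\<exists>a b. sum_count T ` (UNIV - {0}) \<subseteq> {a, b}"
    and "\<not> ((\<forall>z \<in> T. sum_count T z = l) \<and> (\<forall>z. z \<notin> T \<longrightarrow> z \<noteq> 0 \<longrightarrow> sum_count T z = m))"
proof -
  note [simp] = card_common_neighbours_Cay[OF T]
  obtain n k b a where "deza_graph (Cay T) n k b a"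
    using deza by (auto simp: strictly_deza_graph_def)
  then have vals: "{sum_count T (u - v) | u v. u \<noteq> v} = {a, b}" by (simp add: deza_graph_def)
  have "sum_count T z \<in> {a, b}" if "z \<noteq> 0" for z
  proof -
    have "sum_count T (z - 0) \<in> {sum_count T (u - v) | u v. u \<noteq> v}" using that by blast
    then show ?thesis unfolding vals by simp
  qed
  then show "\<exists>a b. sum_count T ` (UNIV - {0}) \<subseteq> {a, b}" by blast
  show "\<not> ((\<forall>z \<in> T. sum_count T z = l) \<and> (\<forall>z. z \<notin> T \<longrightarrow> z \<noteq> 0 \<longrightarrow> sum_count T z = m))"
  proof
    assume "(\<forall>z \<in> T. sum_count T z = l) \<and> (\<forall>z. z \<notin> T \<longrightarrow> z \<noteq> 0 \<longrightarrow> sum_count T z = m)"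
    then have "strongly_regular (Cay T) (card (UNIV :: 'g set)) (card T) l m"
      using pair_graph_Cay[OF T] by (simp add: strongly_regular_def regular_Cay)
    then show False using deza unfolding strictly_deza_graph_def by blast
  qed
qed

section \<open>Cyclotomic classes of order three\<close>

definition conv :: "('g::{ab_group_add, finite} \<Rightarrow> int) \<Rightarrow> ('g \<Rightarrow> int) \<Rightarrow> 'g \<Rightarrow> int" where
  "conv F G z = (\<Sum>y \<in> UNIV. F y * G (z - y))"

lemma conv_commute: "conv F G z = conv G F z"
  unfolding conv_def
  by (rule sum.reindex_bij_witness[of _ "\<lambda>y. z - y" "\<lambda>y. z - y"]) (auto simp: mult.commute)

lemma conv_assoc: "conv (conv F G) H z = conv F (conv G H) z"
proof -
  have "conv (conv F G) H z = (\<Sum>y \<in> UNIV. \<Sum>x \<in> UNIV. F x * G (y - x) * H (z - y))"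
    by (simp add: conv_def sum_distrib_right)
  also have "\<dots> = (\<Sum>x \<in> UNIV. \<Sum>y \<in> UNIV. F x * G (y - x) * H (z - y))"
    by (rule sum.swap)
  also have "\<dots> = (\<Sum>x \<in> UNIV. \<Sum>y \<in> UNIV. F x * G y * H (z - x - y))"
  proof (rule sum.cong[OF refl])
    fix x
    show "(\<Sum>y \<in> UNIV. F x * G (y - x) * H (z - y)) = (\<Sum>y \<in> UNIV. F x * G y * H (z - x - y))"
      by (rule sum.reindex_bij_witness[of _ "\<lambda>y. y + x" "\<lambda>y. y - x"]) (auto simp: algebra_simps)
  qed
  also have "\<dots> = conv F (conv G H) z"
    by (simp add: conv_def sum_distrib_left mult.assoc)
  finally show ?thesis .
qed

lemma conv_add: "conv (\<lambda>z. F z + G z) H z = conv F H z + conv G H z"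
  by (simp add: conv_def sum.distrib algebra_simps)

lemma conv_scale: "conv (\<lambda>z. a * F z) H z = a * conv F H z"
  by (simp add: conv_def sum_distrib_left algebra_simps)

lemma conv_delta: "conv (\<lambda>z. of_bool (z = 0)) H z = H z"
proof -
  have "(\<Sum>y \<in> UNIV. of_bool (y = 0) * H (z - y)) = (\<Sum>y \<in> {0}. of_bool (y = 0) * H (z - y))"
    by (rule sum.mono_neutral_right) auto
  then show ?thesis by (simp add: conv_def)
qed

lemma sum_count_conv:
  "int (sum_count T z) = conv (\<lambda>x. of_bool (x \<in> T)) (\<lambda>x. of_bool (x \<in> T)) z"
  by (simp add: conv_def sum_count_def Int_def)

locale cubic_scheme =
  fixes \<alpha> :: "'a::{field, finite}"
  assumes primitive: "primitive_element \<alpha>" and three: "3 dvd CARD('a) - 1"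
begin

lemma powi_range: "range (\<lambda>n::int. \<alpha> powi n) = UNIV - {0}"
  using primitive by (simp add: primitive_element_def cyclic_subgroup_def)

lemma nonzero: "\<alpha> \<noteq> 0"
proof -
  have "\<alpha> powi 1 \<in> UNIV - {0}" unfolding powi_range[symmetric] by (rule rangeI)
  then show ?thesis by simp
qed

lemma log_exists: "x \<noteq> 0 \<Longrightarrow> \<exists>n::int. x = \<alpha> powi n"
  using powi_range by (metis DiffI UNIV_I imageE singletonD)

lemma powi_mod: "\<alpha> ^ n = 1 \<Longrightarrow> \<alpha> powi m = \<alpha> powi (m mod int n)"
  using nonzero power_int_add[of \<alpha> "m mod int n" "int n * (m div int n)"]
  by (simp add: power_int_mult)

text \<open>The powers below \<open>n\<close> already exhaust the nonzero elements.\<close>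

lemma card_le_order:
  assumes "\<alpha> ^ n = 1" "n > 0"
  shows "CARD('a) - 1 \<le> n"
proof -
  have "UNIV - {0} \<subseteq> (\<lambda>j. \<alpha> ^ j) ` {..<n}"
  proof
    fix x :: 'a assume "x \<in> UNIV - {0}"
    then obtain m where "x = \<alpha> powi m" using log_exists by auto
    then have "x = \<alpha> ^ nat (m mod int n)"
      using powi_mod[OF assms(1), of m] assms(2) by (simp add: power_int_def)
    moreover have "nat (m mod int n) < n" using assms(2) by (simp add: nat_less_iff)
    ultimately show "x \<in> (\<lambda>j. \<alpha> ^ j) ` {..<n}" by auto
  qed
  then have "card (UNIV - {0 :: 'a}) \<le> card ((\<lambda>j. \<alpha> ^ j) ` {..<n})" by (rule card_mono[rotated]) simp
  also have "\<dots> \<le> n" using card_image_le[of "{..<n}"] by simp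
  finally show ?thesis by simp
qed

lemma power_card_minus_1: "\<alpha> ^ (CARD('a) - 1) = 1"
proof -
  let ?N = "CARD('a) - 1"
  have "(\<lambda>j. \<alpha> ^ j) ` {..?N} \<subseteq> UNIV - {0}" using nonzero by auto
  then have "card ((\<lambda>j. \<alpha> ^ j) ` {..?N}) \<le> card (UNIV - {0 :: 'a})" by (intro card_mono) auto
  also have "\<dots> = ?N" by simp
  also have "\<dots> < card {..?N}" by simp
  finally have "\<not> inj_on (\<lambda>j. \<alpha> ^ j) {..?N}" by (rule pigeonhole)
  then obtain i j where ij: "i \<le> ?N" "j \<le> ?N" "i < j" "\<alpha> ^ i = \<alpha> ^ j"
    unfolding inj_on_def by (metis atMost_iff nat_neq_iff)
  have "\<alpha> ^ i * \<alpha> ^ (j - i) = \<alpha> ^ j" using ij(3) by (simp flip: power_add)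
  then have "\<alpha> ^ (j - i) = 1" using nonzero ij(4) by simp
  moreover from this have "?N \<le> j - i" using card_le_order ij by simp
  then have "j - i = ?N" using ij by simp
  ultimately show ?thesis by simp
qed

text \<open>The order of \<open>\<alpha>\<close> is \<open>CARD('a) - 1\<close>, a multiple of 3.
  Hence the exponent modulo 3, and with it the class of an element, is well defined.\<close>

lemma powi_eq_1_imp:
  assumes "\<alpha> powi m = 1"
  shows "3 dvd m"
proof -
  let ?N = "CARD('a) - 1"
  have "card {0, 1 :: 'a} \<le> CARD('a)" by (intro card_mono) auto
  then have N: "?N > 0" by simp
  define k where "k = nat (m mod int ?N)"
  have k: "int k = m mod int ?N" using N by (simp add: k_def)
  have "\<alpha> ^ k = 1" using powi_mod[OF power_card_minus_1, of m] assms k by (metis power_int_of_nat)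
  moreover have "k < ?N" using N by (simp add: k_def nat_less_iff)
  ultimately have "k = 0" using card_le_order by (metis gr0I not_le)
  then have "int ?N dvd m" using k by (simp add: mod_0_imp_dvd)
  then show ?thesis using three by (metis dvd_trans int_dvd_int_iff of_nat_numeral)
qed

abbreviation C where "C \<equiv> cyclotomic_class \<alpha> 3"

lemma mem_C: "x \<in> C i \<longleftrightarrow> (\<exists>n::int. x = \<alpha> powi n \<and> n mod 3 = int i mod 3)"
proof -
  have *: "\<alpha> ^ i * (\<alpha> ^ 3) powi j = \<alpha> powi (int i + 3 * j)" for j
    using nonzero by (simp add: power_int_add power_int_mult)
  show ?thesis
  proof
    assume "x \<in> C i"
    then obtain j where "x = \<alpha> powi (int i + 3 * j)"
      unfolding cyclotomic_class_def cyclic_subgroup_def using * by auto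
    then show "\<exists>n. x = \<alpha> powi n \<and> n mod 3 = int i mod 3" by (intro exI[of _ "int i + 3 * j"]) simp
  next
    assume "\<exists>n. x = \<alpha> powi n \<and> n mod 3 = int i mod 3"
    then obtain n where n: "x = \<alpha> powi n" "n mod 3 = int i mod 3" by blast
    then have "3 dvd n - int i" by (metis mod_eq_dvd_iff)
    then obtain j where "n = int i + 3 * j" by (metis add.commute diff_add_cancel dvdE)
    then have "x = \<alpha> ^ i * (\<alpha> ^ 3) powi j" using n * by simp
    then show "x \<in> C i" unfolding cyclotomic_class_def cyclic_subgroup_def by blast
  qed
qed

lemma powi_mem_C: "\<alpha> powi n \<in> C i \<longleftrightarrow> n mod 3 = int i mod 3"
proof
  assume "\<alpha> powi n \<in> C i"
  then obtain m where m: "\<alpha> powi n = \<alpha> powi m" "m mod 3 = int i mod 3" by (auto simp: mem_C)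
  then have "\<alpha> powi (n - m) = 1" using nonzero by (simp add: power_int_diff)
  then have "3 dvd n - m" by (rule powi_eq_1_imp)
  then show "n mod 3 = int i mod 3" using m(2) by (metis mod_eq_dvd_iff)
qed (auto simp: mem_C)

lemma zero_notin_C [simp]: "0 \<notin> C i"
  using nonzero by (auto simp: mem_C)

lemma power_mem_C: "\<alpha> ^ n \<in> C i \<longleftrightarrow> n mod 3 = i mod 3"
proof -
  have "int n mod 3 = int i mod 3 \<longleftrightarrow> n mod 3 = i mod 3"
    using of_nat_eq_iff[of "n mod 3" "i mod 3", where 'a = int] by (simp add: zmod_int)
  then show ?thesis using powi_mem_C[of "int n" i] by simp
qed

lemma C_mod: "C (i mod 3) = C i"
  by (auto simp: mem_C zmod_int)

lemma power_mult_mem_C: "\<alpha> ^ m * x \<in> C (i + m) \<longleftrightarrow> x \<in> C i"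
proof (cases "x = 0")
  case False
  then obtain n where n: "x = \<alpha> powi n" using log_exists by blast
  have "\<alpha> ^ m * \<alpha> powi n = \<alpha> powi (n + int m)" using nonzero by (simp add: power_int_add)
  then have "\<alpha> ^ m * x \<in> C (i + m) \<longleftrightarrow> (n + int m) mod 3 = (int i + int m) mod 3"
    using n powi_mem_C by simp
  also have "\<dots> \<longleftrightarrow> n mod 3 = int i mod 3" by presburger
  finally show ?thesis using n powi_mem_C by simp
qed simp

lemma mult_C_0:
  assumes "s \<in> C 0"
  shows "s * x \<in> C i \<longleftrightarrow> x \<in> C i"
proof (cases "x = 0")
  case False
  then obtain n where n: "x = \<alpha> powi n" using log_exists by blast
  obtain m where m: "s = \<alpha> powi m" "m mod 3 = 0" using assms by (auto simp: mem_C)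
  have "s * x = \<alpha> powi (m + n)" using nonzero by (simp add: m n power_int_add)
  moreover have "(m + n) mod 3 = n mod 3" using m(2) by presburger
  ultimately show ?thesis using n powi_mem_C by simp
qed simp

text \<open>\<open>- 1\<close> is its own cube; every class is therefore closed under
  negation.\<close>

lemma minus_one_mem: "- 1 \<in> C 0"
proof -
  obtain n where n: "- 1 = \<alpha> powi n" using log_exists[of "- 1"] by auto
  have "- 1 = (- 1 :: 'a) ^ 3" by simp
  also have "\<dots> = \<alpha> powi (n * 3)" unfolding n by (simp add: power_int_mult)
  finally show ?thesis by (simp add: powi_mem_C)
qed

lemma uminus_mem_C: "- x \<in> C i \<longleftrightarrow> x \<in> C i"
  using mult_C_0[OF minus_one_mem, of x i] by simp

lemma C_cases:
  assumes "x \<noteq> 0"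
  obtains "x \<in> C 0" "x \<notin> C 1" "x \<notin> C 2" | "x \<in> C 1" "x \<notin> C 0" "x \<notin> C 2" | "x \<in> C 2" "x \<notin> C 0" "x \<notin> C 1"
proof -
  obtain n where n: "x = \<alpha> powi n" using log_exists assms by blast
  have "n mod 3 = 0 \<or> n mod 3 = 1 \<or> n mod 3 = 2" by presburger
  then show ?thesis using that unfolding n powi_mem_C by auto
qed

lemma C_unique:
  assumes "x \<in> C i" "x \<in> C j"
  shows "i mod 3 = j mod 3"
proof -
  obtain n where "x = \<alpha> powi n" using assms(1) by (auto simp: mem_C)
  then have "int (i mod 3) = int (j mod 3)" using assms by (simp add: powi_mem_C zmod_int)
  then show ?thesis by (simp only: of_nat_eq_iff)
qed

lemma C_disjoint: "i mod 3 \<noteq> j mod 3 \<Longrightarrow> C i \<inter> C j = {}"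
  using C_unique by blast

lemma card_C: "card (C i) = card (C 0)"
proof -
  have "C i = (\<lambda>s. \<alpha> ^ i * s) ` C 0"
    by (simp add: cyclotomic_class_def image_image)
  moreover have "inj_on (\<lambda>s. \<alpha> ^ i * s) (C 0)" using nonzero by (auto intro: inj_onI)
  ultimately show ?thesis by (simp add: card_image)
qed

lemma card_nonzero: "card (UNIV - {0 :: 'a}) = 3 * card (C 0)"
proof -
  have "x \<in> UNIV - {0} \<longleftrightarrow> x \<in> C 0 \<union> (C 1 \<union> C 2)" for x
  proof (cases "x = 0")
    case False
    then show ?thesis by (rule C_cases) (use False in simp_all)
  qed simp
  then have "UNIV - {0} = C 0 \<union> (C 1 \<union> C 2)" by blast
  moreover have "C 0 \<inter> (C 1 \<union> C 2) = {}" "C 1 \<inter> C 2 = {}"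
    by (simp_all only: Int_Un_distrib) (simp_all add: C_disjoint)
  ultimately have "card (UNIV - {0 :: 'a}) = card (C 0) + (card (C 1) + card (C 2))"
    by (simp add: card_Un_disjoint)
  then show ?thesis using card_C[of 1] card_C[of 2] by simp
qed

end

lemma conv_scale_arg:
  fixes s :: "'a::{field, finite}"
  assumes "s \<noteq> 0"
  shows "conv F G (s * z) = conv (\<lambda>y. F (s * y)) (\<lambda>y. G (s * y)) z"
  unfolding conv_def using assms
  by (intro sum.reindex_bij_witness[of _ "\<lambda>y. s * y" "\<lambda>y. y / s"])
    (auto simp: right_diff_distrib)

section \<open>Intersection numbers of the cubic scheme\<close>

context cubic_scheme begin

definition \<chi> :: "nat \<Rightarrow> 'a \<Rightarrow> int" where "\<chi> i x = of_bool (x \<in> C i)"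

text \<open>
  \<open>p i j k\<close> is the number of \<open>(x, y)\<close> in \<open>C i \<times> C j\<close> with \<open>x + y = \<alpha>\<^sup>k\<close>, an intersection number of
  the scheme because the classes are closed under negation.
\<close>

definition p :: "nat \<Rightarrow> nat \<Rightarrow> nat \<Rightarrow> int" where "p i j k = conv (\<chi> i) (\<chi> j) (\<alpha> ^ k)"

lemma \<chi>_add_3 [simp]: "\<chi> (i + 3) = \<chi> i"
  using C_mod[of "i + 3"] C_mod[of i] by (simp add: \<chi>_def fun_eq_iff)

lemma conv_C_0:
  assumes s: "s \<in> C 0"
  shows "conv (\<chi> i) (\<chi> j) (s * z) = conv (\<chi> i) (\<chi> j) z"
proof -
  have "s \<noteq> 0" using s zero_notin_C by metis
  then show ?thesis by (simp add: conv_scale_arg \<chi>_def [abs_def] mult_C_0[OF s])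
qed

lemma conv_shift: "conv (\<chi> (i + m)) (\<chi> (j + m)) (\<alpha> ^ m * z) = conv (\<chi> i) (\<chi> j) z"
  using nonzero by (simp add: conv_scale_arg \<chi>_def [abs_def] power_mult_mem_C)

text \<open>Multiplication by an element of \<open>C 0\<close> preserves every class, so the
  convolution is constant on classes.\<close>

lemma conv_class:
  assumes "z \<in> C k"
  shows "conv (\<chi> i) (\<chi> j) z = p i j k"
proof -
  obtain s where s: "z = \<alpha> ^ k * s" "s \<in> cyclic_subgroup (\<alpha> ^ 3)"
    using assms by (auto simp: cyclotomic_class_def)
  then have "s \<in> C 0" by (auto simp: cyclotomic_class_def)
  then show ?thesis using conv_C_0[of s i j "\<alpha> ^ k"] by (simp add: s(1) p_def mult.commute)
qed

lemma p_add_3: "p (i + 3) j k = p i j k" "p i (j + 3) k = p i j k" "p i j (k + 3) = p i j k"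
proof -
  show "p i j (k + 3) = p i j k"
    using conv_class[of "\<alpha> ^ k" "k + 3"] conv_class[of "\<alpha> ^ k" k] by (simp add: power_mem_C)
qed (simp_all add: p_def)

lemma p_commute: "p i j k = p j i k"
  by (simp add: p_def conv_commute)

lemma p_shift: "p (i + m) (j + m) (k + m) = p i j k"
  using conv_shift[of i m j "\<alpha> ^ k"] by (simp add: p_def power_add mult.commute)

text \<open>Shifting all three indices, reducing modulo 3 and commuting bring every intersection
  number to the form \<open>p 0 0 k\<close> or \<open>p 0 1 k\<close>.\<close>

lemma p_values:
  "p 1 1 0 = p 0 0 2" "p 1 1 1 = p 0 0 0" "p 1 1 2 = p 0 0 1"
  "p 2 2 0 = p 0 0 1" "p 2 2 1 = p 0 0 2" "p 2 2 2 = p 0 0 0"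
  "p 1 2 0 = p 0 1 2" "p 1 2 1 = p 0 1 0" "p 1 2 2 = p 0 1 1"
  "p 0 2 0 = p 0 1 1" "p 0 2 1 = p 0 1 2" "p 0 2 2 = p 0 1 0"
proof -
  show "p 1 1 0 = p 0 0 2"
    using p_shift[of 0 1 0 2] p_add_3(3)[of 1 1 0] by (simp add: numeral_eq_Suc)
  show "p 1 1 1 = p 0 0 0"
    using p_shift[of 0 1 0 0] by (simp add: numeral_eq_Suc)
  show "p 1 1 2 = p 0 0 1"
    using p_shift[of 0 1 0 1] by (simp add: numeral_eq_Suc)
  show "p 2 2 0 = p 0 0 1"
    using p_shift[of 0 2 0 1] p_add_3(3)[of 2 2 0] by (simp add: numeral_eq_Suc)
  show "p 2 2 1 = p 0 0 2"
    using p_shift[of 0 2 0 2] p_add_3(3)[of 2 2 1] by (simp add: numeral_eq_Suc)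
  show "p 2 2 2 = p 0 0 0"
    using p_shift[of 0 2 0 0] by (simp add: numeral_eq_Suc)
  show "p 1 2 0 = p 0 1 2"
    using p_shift[of 0 1 1 2] p_add_3(3)[of 1 2 0] by (simp add: numeral_eq_Suc)
  show "p 1 2 1 = p 0 1 0"
    using p_shift[of 0 1 1 0] by (simp add: numeral_eq_Suc)
  show "p 1 2 2 = p 0 1 1"
    using p_shift[of 0 1 1 1] by (simp add: numeral_eq_Suc)
  show "p 0 2 0 = p 0 1 1"
    using p_shift[of 0 2 1 1] p_add_3(3)[of 2 3 0] p_add_3(2)[of 2 0 0] p_commute[of 2 0 0] by (simp add: numeral_eq_Suc)
  show "p 0 2 1 = p 0 1 2"
    using p_shift[of 0 2 1 2] p_add_3(3)[of 2 3 1] p_add_3(2)[of 2 0 1] p_commute[of 2 0 1] by (simp add: numeral_eq_Suc)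
  show "p 0 2 2 = p 0 1 0"
    using p_shift[of 0 2 1 0] p_add_3(2)[of 2 0 2] p_commute[of 2 0 2] by (simp add: numeral_eq_Suc)
qed

lemma \<chi>_zero [simp]: "\<chi> i 0 = 0"
  by (simp add: \<chi>_def)

lemma conv_zero:
  "conv (\<chi> i) (\<chi> j) 0 = int (card (C i \<inter> C j))"
  by (simp add: conv_def \<chi>_def uminus_mem_C Int_def flip: of_bool_conj)

lemma \<chi>_sum: "of_bool (z = 0) + \<chi> 0 z + \<chi> 1 z + \<chi> 2 z = 1"
proof (cases "z = 0")
  case False
  then show ?thesis by (rule C_cases) (use False in \<open>simp_all add: \<chi>_def\<close>)
qed simp

lemma conv_eq:
  "conv (\<chi> i) (\<chi> j) z = int (card (C i \<inter> C j)) * of_bool (z = 0) + p i j 0 * \<chi> 0 z + p i j 1 * \<chi> 1 z + p i j 2 * \<chi> 2 z"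
proof (cases "z = 0")
  case False
  then show ?thesis by (rule C_cases) (use False in \<open>simp_all add: conv_class \<chi>_def\<close>)
qed (simp add: conv_zero)

lemma conv_conv:
  "conv (conv (\<chi> i) (\<chi> j)) H z = int (card (C i \<inter> C j)) * H z +
     p i j 0 * conv (\<chi> 0) H z + p i j 1 * conv (\<chi> 1) H z + p i j 2 * conv (\<chi> 2) H z"
proof -
  have "conv (\<chi> i) (\<chi> j) = (\<lambda>z. int (card (C i \<inter> C j)) * of_bool (z = 0) + p i j 0 * \<chi> 0 z + p i j 1 * \<chi> 1 z + p i j 2 * \<chi> 2 z)"
    using conv_eq by blast
  then show ?thesis by (simp only: conv_add conv_scale conv_delta)
qed

lemma conv_conv_swap: "conv (conv (\<chi> i) (\<chi> j)) (\<chi> l) z = conv (conv (\<chi> j) (\<chi> l)) (\<chi> i) z"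
  by (simp only: conv_assoc conv_commute[of "\<chi> i"])

lemma card_C_0_pos: "card (C 0) > 0"
proof -
  have "1 \<in> C 0" using power_mem_C[of 0 0] by simp
  then show ?thesis by (auto simp: card_gt_0_iff)
qed

text \<open>Double counting of the zero-sum triples in \<open>C 0\<close>, \<open>C 0\<close>,
  \<open>C 1\<close>, and likewise with \<open>C 2\<close>: the triple convolution at
  \<open>0\<close> is evaluated with two different bracketings.\<close>

lemma p_mixed: "p 0 1 0 = p 0 0 1" "p 0 1 1 = p 0 0 2"
proof -
  have "conv (conv (\<chi> 0) (\<chi> 0)) (\<chi> 1) 0 = p 0 0 1 * card (C 0)"
    unfolding conv_conv by (simp add: conv_zero C_disjoint card_C[of 1] del: One_nat_def)
  moreover have "conv (conv (\<chi> 0) (\<chi> 1)) (\<chi> 0) 0 = p 0 1 0 * card (C 0)"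
    unfolding conv_conv by (simp add: conv_zero C_disjoint del: One_nat_def)
  ultimately show "p 0 1 0 = p 0 0 1" using conv_conv_swap[of 0 0 1 0] card_C_0_pos by auto
  have "conv (conv (\<chi> 0) (\<chi> 0)) (\<chi> 2) 0 = p 0 0 2 * card (C 0)"
    unfolding conv_conv by (simp add: conv_zero C_disjoint card_C[of 2] del: One_nat_def)
  moreover have "conv (conv (\<chi> 0) (\<chi> 2)) (\<chi> 0) 0 = p 0 2 0 * card (C 0)"
    unfolding conv_conv by (simp add: conv_zero C_disjoint del: One_nat_def)
  ultimately have "p 0 2 0 = p 0 0 2" using conv_conv_swap[of 0 0 2 0] card_C_0_pos by auto
  then show "p 0 1 1 = p 0 0 2" using p_values by simp
qed

lemma row_sum: "\<chi> 0 z + conv (\<chi> 0) (\<chi> 0) z + conv (\<chi> 0) (\<chi> 1) z + conv (\<chi> 0) (\<chi> 2) z = card (C 0)"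
proof -
  have "\<chi> 0 z + conv (\<chi> 0) (\<chi> 0) z + conv (\<chi> 1) (\<chi> 0) z + conv (\<chi> 2) (\<chi> 0) z =
      conv (\<lambda>z. of_bool (z = 0) + \<chi> 0 z + \<chi> 1 z + \<chi> 2 z) (\<chi> 0) z"
    by (simp only: conv_add conv_delta)
  also have "\<dots> = conv (\<chi> 0) (\<lambda>_. 1) z" unfolding \<chi>_sum by (rule conv_commute)
  also have "\<dots> = card (C 0)" by (simp add: conv_def \<chi>_def)
  finally show ?thesis by (simp only: conv_commute)
qed

text \<open>The row sum evaluated at \<open>1\<close> in \<open>C 0\<close> and at
  \<open>\<alpha>\<^sup>2\<close> in \<open>C 2\<close>. The two differ by the term
  \<open>\<chi> 0 z\<close>, the source of the summand 1.\<close>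

lemma p_sum: "p 0 0 0 + p 0 0 1 + p 0 0 2 = int (card (C 0)) - 1"
  and p_0_1_2: "p 0 1 2 = p 0 0 0 + 1"
proof -
  have m: "1 \<in> C 0" "\<alpha>\<^sup>2 \<in> C 2" "\<alpha>\<^sup>2 \<notin> C 0" using power_mem_C[of 0 0] by (simp_all add: power_mem_C)
  show s: "p 0 0 0 + p 0 0 1 + p 0 0 2 = int (card (C 0)) - 1"
    using row_sum[of 1] m(1) p_values p_mixed by (simp add: conv_class \<chi>_def)
  show "p 0 1 2 = p 0 0 0 + 1"
    using row_sum[of "\<alpha>\<^sup>2"] m(2,3) p_values p_mixed s by (simp add: conv_class \<chi>_def)
qed

text \<open>Two bracketings of the triple convolution of \<open>\<chi> 0\<close>,
  \<open>\<chi> 0\<close>, \<open>\<chi> 1\<close>, compared at an element of the remaining class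
  \<open>C 2\<close>.\<close>

lemma p_quadratic:
  "p 0 0 0 * (p 0 0 0 + 1) + (p 0 0 2)\<^sup>2 + (p 0 0 1)\<^sup>2 =
     p 0 0 2 * p 0 0 1 + (p 0 0 0 + 1) * (p 0 0 2 + p 0 0 1)"
proof -
  have m: "\<alpha>\<^sup>2 \<in> C 2" "\<alpha>\<^sup>2 \<notin> C 0" "\<alpha>\<^sup>2 \<notin> C 1" by (simp_all add: power_mem_C)
  show ?thesis
    using conv_conv_swap[of 0 0 1 "\<alpha>\<^sup>2"] m p_values p_mixed p_0_1_2
      p_commute[of 2 1] p_commute[of 1 0] p_commute[of 2 0]
    unfolding conv_conv by (simp add: conv_class \<chi>_def power2_eq_square algebra_simps)
qed

end

text \<open>Multiplication by \<open>s\<close> is an automorphism of the additive group and maps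
  \<open>T\<close> onto the other connection set.\<close>

lemma isomorphic_Cay_mult:
  fixes s :: "'a::{field, finite}"
  assumes s: "s \<noteq> 0" and T: "connection_set T"
  shows "isomorphic_graphs (Cay T) (Cay ((\<lambda>x. s * x) ` T))"
proof -
  define f where "f = (\<lambda>x. s * x)"
  define hom where "hom = \<lparr>iso_verts = f, iso_arcs = map_prod f f, iso_head = snd, iso_tail = fst\<rparr>"
  have "inj f" using s by (simp add: f_def inj_def)
  then have "inj (map_prod f f)" by (simp add: prod.inj_map)
  interpret G: pair_graph "Cay T" using T by (rule pair_graph_Cay)
  have "G.digraph_isomorphism hom"
    unfolding G.digraph_isomorphism_def hom_def
    using \<open>inj f\<close> \<open>inj (map_prod f f)\<close> G.wf_digraph by (auto intro: inj_on_subset)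
  moreover have "map_prod f f ` parcs (Cay T) = parcs (Cay (f ` T))"
  proof (intro set_eqI iffI)
    fix e assume "e \<in> parcs (Cay (f ` T))"
    then obtain x y t where e: "e = (x, y)" "x - y = s * t" "t \<in> T"
      by (cases e) (auto simp: f_def)
    have "e = map_prod f f (x / s, y / s)" using s by (simp add: e(1) f_def)
    moreover have "x / s - y / s = t" using e(2) s by (simp flip: diff_divide_distrib)
    then have "(x / s, y / s) \<in> parcs (Cay T)" using e(3) by simp
    ultimately show "e \<in> map_prod f f ` parcs (Cay T)" by (rule image_eqI)
  qed (auto simp: f_def simp flip: right_diff_distrib)
  moreover have "range f = UNIV" using \<open>inj f\<close> by (simp add: finite_UNIV_inj_surj)
  ultimately show ?thesis
    unfolding isomorphic_graphs_def digraph_iso_def f_def[symmetric]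
    by (intro exI[of _ hom]) (simp add: app_iso_def hom_def with_proj_def)
qed

text \<open>Both graphs at once: \<open>X\<close> is either the set of neighbours of
  \<open>0\<close> or the set of nonzero non-neighbours, so \<open>Y\<close> and \<open>Z\<close>
  are on the same side. Strong regularity means \<open>y = z\<close>, and having only two values
  then requires \<open>x\<close> to be \<open>y\<close> or \<open>z\<close>.\<close>

lemma strictly_deza_three_classes:
  fixes T :: "'g::{ab_group_add, finite} set"
  assumes T: "connection_set T" "T = X \<or> T = Y \<union> Z"
    and part: "UNIV - {0} = X \<union> Y \<union> Z" "X \<inter> (Y \<union> Z) = {}"
    and ne: "x0 \<in> X" "y0 \<in> Y" "z0 \<in> Z"
    and x: "\<And>w. w \<in> X \<Longrightarrow> sum_count T w = x" and y: "\<And>w. w \<in> Y \<Longrightarrow> sum_count T w = y"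
    and z: "\<And>w. w \<in> Z \<Longrightarrow> sum_count T w = z"
  shows "strictly_deza_graph (Cay T) \<Longrightarrow> (x = y \<or> x = z) \<and> y \<noteq> z"
    and "(x = y \<or> x = z) \<and> y \<noteq> z \<Longrightarrow> (\<And>w. w \<notin> T \<Longrightarrow> w \<noteq> 0 \<Longrightarrow> sum_count T w > 0) \<Longrightarrow>
      strictly_deza_graph (Cay T)"
proof -
  have im: "sum_count T ` (UNIV - {0}) = {x, y, z}"
    unfolding part using ne x y z by (force simp: image_Un)
  have mem: "w \<noteq> 0 \<longleftrightarrow> w \<in> X \<or> w \<in> Y \<or> w \<in> Z" for w using part(1) by blast
  {
    assume deza: "strictly_deza_graph (Cay T)"
    have "y \<noteq> z"
    proof
      assume "y = z"
      then have "\<exists>l m. (\<forall>w \<in> T. sum_count T w = l) \<and> (\<forall>w. w \<notin> T \<longrightarrow> w \<noteq> 0 \<longrightarrow> sum_count T w = m)"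
        using T(2) x y z mem by blast
      then show False using strictly_deza_CayD(2)[OF T(1) deza] by blast
    qed
    moreover obtain a b where "{x, y, z} \<subseteq> {a, b}"
      using strictly_deza_CayD(1)[OF T(1) deza] im by auto
    ultimately show "(x = y \<or> x = z) \<and> y \<noteq> z" by auto
  next
    assume eq: "(x = y \<or> x = z) \<and> y \<noteq> z"
      and pos: "\<And>w. w \<notin> T \<Longrightarrow> w \<noteq> 0 \<Longrightarrow> sum_count T w > 0"
    obtain w where w: "w \<notin> T" "w \<noteq> 0" using T(2) part ne by blast
    show "strictly_deza_graph (Cay T)"
    proof (rule strictly_deza_CayI[OF T(1)])
      show "sum_count T ` (UNIV - {0}) = {y, z}" using im eq by auto
      show "y0 \<noteq> 0" "z0 \<noteq> 0" using mem ne by blast+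
      show "y0 \<in> T \<longleftrightarrow> z0 \<in> T" using T(2) part(2) ne by blast
      show "sum_count T y0 \<noteq> sum_count T z0" using eq ne y z by simp
    qed (use w pos in auto)
  }
qed

section \<open>The graphs of the cubic scheme\<close>

context cubic_scheme begin

lemma C_def: "C i = (\<lambda>s. \<alpha> ^ i * s) ` cyclic_subgroup (\<alpha> ^ 3)"
  by (simp add: cyclotomic_class_def)

lemma C_0: "C 0 = cyclic_subgroup (\<alpha> ^ 3)"
  by (simp add: C_def)

lemma C_3: "C 3 = C 0"
  using C_mod[of 3] by simp

lemma C_add: "C (i + m) = (\<lambda>s. \<alpha> ^ m * s) ` C i"
  by (simp add: C_def image_image power_add mult_ac)

lemma C_partition: "UNIV - {0} = C 0 \<union> C 1 \<union> C 2"
proof (intro set_eqI iffI)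
  fix x :: 'a assume "x \<in> UNIV - {0}"
  then have "x \<noteq> 0" by simp
  then show "x \<in> C 0 \<union> C 1 \<union> C 2" by (rule C_cases) simp_all
qed auto

lemma connection_set_C: "connection_set (C i)"
  unfolding connection_set_def using uminus_mem_C
  by (auto intro!: image_eqI[of _ uminus "- x" for x])

lemma connection_set_compl: "connection_set (UNIV - {0} - C i)"
  unfolding connection_set_def using uminus_mem_C
  by (auto intro!: image_eqI[of _ uminus "- x" for x])

lemma Gamma_eq_Cay: "i \<noteq> 0 \<Longrightarrow> Gamma \<alpha> i = Cay (C i)"
  by (simp add: Gamma_def Cay_def cyclotomic_relation_def)

lemma Gamma_bar_eq_Cay:
  assumes "i \<in> {1, 2, 3}"
  shows "Gamma_bar \<alpha> i = Cay (UNIV - {0} - C i)"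
proof -
  have dj: "C 1 \<inter> C 2 = {}" "C 1 \<inter> C 3 = {}" "C 2 \<inter> C 3 = {}" by (simp_all add: C_disjoint)
  have "(\<Union>j \<in> {1, 2, 3} - {i}. C j) = UNIV - {0} - C i"
    unfolding C_partition C_3[symmetric] using assms dj by auto
  moreover have "(\<Union>j \<in> {1, 2, 3} - {i}. cyclotomic_relation \<alpha> 3 j) =
      {(x, y). x - y \<in> (\<Union>j \<in> {1, 2, 3} - {i}. C j)}"
    by (auto simp: cyclotomic_relation_def split: if_splits)
  ultimately show ?thesis by (simp add: Gamma_bar_def Cay_def)
qed

lemma isomorphic_Cay_C:
  "isomorphic_graphs (Cay (C i)) (Cay (C j))"
  "isomorphic_graphs (Cay (UNIV - {0} - C i)) (Cay (UNIV - {0} - C j))"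
proof -
  \<comment> \<open>\<open>i + m\<close> is \<open>j + 3 i\<close>; adding \<open>2 * i\<close>
    replaces a subtraction of \<open>i\<close>, which natural numbers would truncate.\<close>
  define m where "m = j + 2 * i"
  have "C j = C (i + m)" using C_mod[of j] C_mod[of "i + m"] by (simp add: m_def)
  then have j: "C j = (\<lambda>x. \<alpha> ^ m * x) ` C i" by (simp add: C_add)
  have m: "\<alpha> ^ m \<noteq> 0" using nonzero by simp
  then have inj: "inj (\<lambda>x. \<alpha> ^ m * x)" by (auto intro: injI)
  then have "range (\<lambda>x. \<alpha> ^ m * x) = UNIV" by (simp add: finite_UNIV_inj_surj)
  then have "(\<lambda>x. \<alpha> ^ m * x) ` (UNIV - {0} - C i) = UNIV - {0} - C j"
    using inj by (simp add: image_set_diff j)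
  then show "isomorphic_graphs (Cay (UNIV - {0} - C i)) (Cay (UNIV - {0} - C j))"
    using isomorphic_Cay_mult[OF m connection_set_compl[of i]] by simp
  show "isomorphic_graphs (Cay (C i)) (Cay (C j))"
    using isomorphic_Cay_mult[OF m connection_set_C[of i]] by (simp add: j)
qed

lemma class_representatives: "1 \<in> C 0" "\<alpha> \<in> C 1" "\<alpha>\<^sup>2 \<in> C 2"
  using power_mem_C[of 0 0] power_mem_C[of 1 1] power_mem_C[of 2 2] by simp_all

lemma sum_count_C_1: "z \<in> C k \<Longrightarrow> int (sum_count (C 1) z) = p 1 1 k"
  using sum_count_conv[of "C 1" z] conv_class[of z k 1 1] by (simp add: \<chi>_def [abs_def])

lemma sum_count_compl:
  assumes "z \<in> C k"
  shows "int (sum_count (UNIV - {0} - C 3) z) = p 1 1 k + 2 * p 1 2 k + p 2 2 k"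
proof -
  have "UNIV - {0} - C 3 = C 1 \<union> C 2"
    unfolding C_partition C_3 using C_disjoint[of 0 1] C_disjoint[of 0 2] by auto
  moreover have "of_bool (x \<in> C 1 \<union> C 2) = \<chi> 1 x + \<chi> 2 x" for x
    using C_disjoint[of 1 2] by (auto simp: \<chi>_def)
  ultimately have "int (sum_count (UNIV - {0} - C 3) z) =
      conv (\<lambda>x. \<chi> 1 x + \<chi> 2 x) (\<lambda>x. \<chi> 1 x + \<chi> 2 x) z"
    by (simp only: sum_count_conv)
  also have "\<dots> = conv (\<chi> 1) (\<chi> 1) z + conv (\<chi> 2) (\<chi> 1) z + (conv (\<chi> 1) (\<chi> 2) z + conv (\<chi> 2) (\<chi> 2) z)"
    by (simp only: conv_add conv_commute[of _ "\<lambda>x. \<chi> 1 x + \<chi> 2 x"])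
  finally show ?thesis
    using assms p_commute[of 2 1 k] by (simp add: conv_class)
qed

lemma card_eq: "int CARD('a) = 3 * int (card (C 0)) + 1"
proof -
  have "CARD('a) - 1 = 3 * card (C 0)" using card_nonzero by simp
  moreover have "CARD('a) > 0" by simp
  ultimately have "CARD('a) = 3 * card (C 0) + 1" by linarith
  then show ?thesis by simp
qed

lemma p_nonneg: "p i j k \<ge> 0"
  by (simp add: p_def conv_def \<chi>_def sum_nonneg)

lemma cyclotomic_numbers:
  assumes "primepow CARD('a)"
  shows "cyclotomic_numbers CARD('a) (p 0 0 0) (p 0 0 2) (p 0 0 1) (int (card (C 0)))"
  using assms card_eq p_sum p_quadratic by unfold_locales simp_all

lemma strictly_deza_Gamma_1:
  assumes pp: "primepow CARD('a)" and "CARD('a) \<noteq> 7"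
  shows "strictly_deza_graph (Cay (C 1)) \<longleftrightarrow> prime CARD('a) \<and> (\<exists>x. int CARD('a) = x\<^sup>2 + 3)"
proof -
  interpret cyclotomic_numbers "CARD('a)" "p 0 0 0" "p 0 0 2" "p 0 0 1" "int (card (C 0))"
    using cyclotomic_numbers pp .
  interpret sw: cyclotomic_numbers "CARD('a)" "p 0 0 0" "p 0 0 1" "p 0 0 2" "int (card (C 0))"
    by (rule swap)
  have v: "z \<in> C 1 \<Longrightarrow> sum_count (C 1) z = nat (p 0 0 0)"
    "z \<in> C 0 \<Longrightarrow> sum_count (C 1) z = nat (p 0 0 2)"
    "z \<in> C 2 \<Longrightarrow> sum_count (C 1) z = nat (p 0 0 1)" for z
    using sum_count_C_1[of z 1] sum_count_C_1[of z 0] sum_count_C_1[of z 2] unfolding p_values by auto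
  have part: "UNIV - {0} = C 1 \<union> C 0 \<union> C 2" "C 1 \<inter> (C 0 \<union> C 2) = {}"
    unfolding C_partition Int_Un_distrib by (auto simp: C_disjoint)
  note three = strictly_deza_three_classes[OF connection_set_C disjI1[OF refl] part
      class_representatives(2,1,3) v(1) v(2) v(3)]
  show ?thesis
  proof
    assume "strictly_deza_graph (Cay (C 1))"
    then have "(p 0 0 0 = p 0 0 2 \<or> p 0 0 0 = p 0 0 1) \<and> p 0 0 2 \<noteq> p 0 0 1"
      using three(1) p_nonneg by (simp add: eq_nat_nat_iff)
    then show "prime CARD('a) \<and> (\<exists>x. int CARD('a) = x\<^sup>2 + 3)"
      using square_plus_3_forward sw.square_plus_3_forward by metis
  next
    assume "prime CARD('a) \<and> (\<exists>x. int CARD('a) = x\<^sup>2 + 3)"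
    then have eq: "(p 0 0 0 = p 0 0 2 \<or> p 0 0 0 = p 0 0 1) \<and> p 0 0 2 \<noteq> p 0 0 1"
      and pos: "p 0 0 2 > 0" "p 0 0 1 > 0"
      using square_plus_3_backward assms(2) by blast+
    \<comment> \<open>The non-neighbours of \<open>0\<close> form the classes \<open>C 0\<close> and
      \<open>C 2\<close>, with counts \<open>p 0 0 2\<close> and \<open>p 0 0 1\<close>. Their
      positivity gives diameter 2.\<close>
    have "sum_count (C 1) w > 0" if "w \<notin> C 1" "w \<noteq> 0" for w
    proof -
      have "w \<in> C 0 \<or> w \<in> C 2" using that C_partition by blast
      then show ?thesis using v(2,3) pos by auto
    qed
    then show "strictly_deza_graph (Cay (C 1))"
      using three(2) eq p_nonneg by (simp add: eq_nat_nat_iff)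
  qed
qed

lemma strictly_deza_Gamma_bar_3:
  assumes pp: "primepow CARD('a)"
  shows "strictly_deza_graph (Cay (UNIV - {0} - C 3)) \<longleftrightarrow>
    prime CARD('a) \<and> (\<exists>x. int CARD('a) = x\<^sup>2 + 12)"
proof -
  interpret cyclotomic_numbers "CARD('a)" "p 0 0 0" "p 0 0 2" "p 0 0 1" "int (card (C 0))"
    using cyclotomic_numbers pp .
  interpret sw: cyclotomic_numbers "CARD('a)" "p 0 0 0" "p 0 0 1" "p 0 0 2" "int (card (C 0))"
    by (rule swap)
  define T where "T = UNIV - {0} - C 3"
  \<comment> \<open>The counts \<open>p 1 1 k + 2 * p 1 2 k + p 2 2 k\<close> for
    \<open>k = 0, 1, 2\<close>, rewritten by the relations among intersection numbers. The summand 2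
    makes \<open>x\<close>, the count of non-adjacent pairs, positive.\<close>
  define x y z where "x = p 0 0 2 + p 0 0 1 + 2 * (p 0 0 0 + 1)"
    and "y = p 0 0 0 + p 0 0 2 + 2 * p 0 0 1" and "z = p 0 0 0 + p 0 0 1 + 2 * p 0 0 2"
  have nonneg: "x > 0" "y \<ge> 0" "z \<ge> 0"
    using p_nonneg[of 0 0 0] p_nonneg[of 0 0 1] p_nonneg[of 0 0 2] by (simp_all add: x_def y_def z_def)
  have v: "w \<in> C 0 \<Longrightarrow> sum_count T w = nat x" "w \<in> C 1 \<Longrightarrow> sum_count T w = nat y"
    "w \<in> C 2 \<Longrightarrow> sum_count T w = nat z" for w
    using sum_count_compl[of w 0] sum_count_compl[of w 1] sum_count_compl[of w 2]
    unfolding p_values p_mixed p_0_1_2 T_def x_def y_def z_def by auto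
  have part: "UNIV - {0} = C 0 \<union> C 1 \<union> C 2" "C 0 \<inter> (C 1 \<union> C 2) = {}"
    unfolding Int_Un_distrib by (rule C_partition) (simp add: C_disjoint)
  have T: "connection_set T" "T = C 0 \<or> T = C 1 \<union> C 2"
    using connection_set_compl part unfolding T_def C_3 by auto
  note three = strictly_deza_three_classes[OF T part class_representatives v(1) v(2) v(3)]
  \<comment> \<open>\<open>x = z\<close> means \<open>p 0 0 0 + 2 = p 0 0 2\<close>, and
    \<open>x = y\<close> means \<open>p 0 0 0 + 2 = p 0 0 1\<close>; the two alternatives appear in
    the opposite order.\<close>
  have iff: "(nat x = nat y \<or> nat x = nat z) \<and> nat y \<noteq> nat z \<longleftrightarrow>
      (p 0 0 0 + 2 = p 0 0 2 \<or> p 0 0 0 + 2 = p 0 0 1) \<and> p 0 0 2 \<noteq> p 0 0 1"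
    using nonneg by (auto simp: eq_nat_nat_iff) (auto simp: x_def y_def z_def)
  show ?thesis
    unfolding T_def[symmetric]
  proof
    assume "strictly_deza_graph (Cay T)"
    then have "(p 0 0 0 + 2 = p 0 0 2 \<or> p 0 0 0 + 2 = p 0 0 1) \<and> p 0 0 2 \<noteq> p 0 0 1"
      using three(1) iff by simp
    then show "prime CARD('a) \<and> (\<exists>x. int CARD('a) = x\<^sup>2 + 12)"
      using square_plus_12_forward sw.square_plus_12_forward by metis
  next
    assume "prime CARD('a) \<and> (\<exists>x. int CARD('a) = x\<^sup>2 + 12)"
    then have "(p 0 0 0 + 2 = p 0 0 2 \<or> p 0 0 0 + 2 = p 0 0 1) \<and> p 0 0 2 \<noteq> p 0 0 1"
      using square_plus_12_backward by blast
    then have "(nat x = nat y \<or> nat x = nat z) \<and> nat y \<noteq> nat z" using iff by blast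
    moreover have "sum_count T w > 0" if "w \<notin> T" "w \<noteq> 0" for w
    proof -
      have "w \<in> C 0" using that unfolding T_def C_3 by blast
      then show ?thesis using v(1) nonneg(1) by simp
    qed
    ultimately show "strictly_deza_graph (Cay T)" using three(2) by blast
  qed
qed

end

theorem theorem14:
  fixes q :: nat and \<alpha> :: "'a::{field, finite}"
  assumes "primepow q" and "CARD('a) = q" and "3 dvd q - 1"
    and "primitive_element \<alpha>"
    and "symmetric_cyclotomic_scheme \<alpha> 3"
  shows
    "(let S = cyclic_subgroup (\<alpha> ^ 3) in
        card (UNIV - {0 :: 'a}) = 3 * card S \<and>
        (\<forall>i \<in> {1, 2, 3}.
           let T = (\<lambda>s. \<alpha> ^ i * s) ` S in
             connection_set T \<and> Gamma \<alpha> i = Cay T \<and>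
             connection_set (UNIV - {0} - T) \<and> Gamma_bar \<alpha> i = Cay (UNIV - {0} - T))) \<and>
     (\<forall>i \<in> {1, 2, 3}. \<forall>j \<in> {1, 2, 3}. isomorphic_graphs (Gamma \<alpha> i) (Gamma \<alpha> j)) \<and>
     (\<forall>i \<in> {1, 2, 3}. \<forall>j \<in> {1, 2, 3}. isomorphic_graphs (Gamma_bar \<alpha> i) (Gamma_bar \<alpha> j)) \<and>
     (q \<noteq> 7 \<longrightarrow>
        (strictly_deza_graph (Gamma \<alpha> 1) \<longleftrightarrow> prime q \<and> (\<exists>x::int. int q = x ^ 2 + 3))) \<and>
     (strictly_deza_graph (Gamma_bar \<alpha> 3) \<longleftrightarrow> prime q \<and> (\<exists>x::int. int q = x ^ 2 + 12))"
proof -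
  interpret cubic_scheme \<alpha>
    using assms(2,3,4) by unfold_locales simp_all
  have C: "(\<lambda>s. \<alpha> ^ i * s) ` cyclic_subgroup (\<alpha> ^ 3) = cyclotomic_class \<alpha> 3 i" for i
    by (simp add: cyclotomic_class_def)
  have pp: "primepow CARD('a)" using assms(1,2) by simp
  have 1: "let S = cyclic_subgroup (\<alpha> ^ 3) in
        card (UNIV - {0 :: 'a}) = 3 * card S \<and>
        (\<forall>i \<in> {1, 2, 3}.
           let T = (\<lambda>s. \<alpha> ^ i * s) ` S in
             connection_set T \<and> Gamma \<alpha> i = Cay T \<and>
             connection_set (UNIV - {0} - T) \<and> Gamma_bar \<alpha> i = Cay (UNIV - {0} - T))"
    unfolding Let_def C
    using card_nonzero connection_set_C connection_set_compl Gamma_eq_Cay Gamma_bar_eq_Cay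
    by (simp add: C_0)
  have G: "Gamma \<alpha> i = Cay (cyclotomic_class \<alpha> 3 i)"
    "Gamma_bar \<alpha> i = Cay (UNIV - {0} - cyclotomic_class \<alpha> 3 i)" if "i \<in> {1, 2, 3}" for i
    using that Gamma_eq_Cay[of i] Gamma_bar_eq_Cay[of i] by auto
  have 2: "isomorphic_graphs (Gamma \<alpha> i) (Gamma \<alpha> j)"
    "isomorphic_graphs (Gamma_bar \<alpha> i) (Gamma_bar \<alpha> j)" if "i \<in> {1, 2, 3}" "j \<in> {1, 2, 3}" for i j
    unfolding G[OF that(1)] G[OF that(2)] by (rule isomorphic_Cay_C)+
  show ?thesis
    using 1 2 strictly_deza_Gamma_1[OF pp] strictly_deza_Gamma_bar_3[OF pp] G[of 1] G[of 3] assms(2)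
    by (intro conjI ballI impI) simp_all
qed

end
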